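(* Let $\Omega \subset \mathbb{R}^2$ be a non-empty, open, bounded, convex set. Then there exists $\hat{K} \in \mathcal{K}_2$ such that \[ \mathcal{J}_\Omega[\hat{K}] = \min_{K \in \mathcal{K}_2} \mathcal{J}_\Omega[K]. \]
   Context: $\mathcal{K}_2$ denotes the class of non-empty, open, bounded, convex subsets of $\mathbb{R}^2$ that are centrally symmetric with respect to the origin. For $K \in \mathcal{K}_2$, the polar set is $K^\circ := \{x \in \mathbb{R}^2 : x\cdot y < 1 \text{ for every } y \in K\}$, and the polar norm is $\Phi_K^\circ(x) := \sup\{x\cdot y : y \in K\}$ for $x\in\mathbb{R}^2$. The anisotropic perimeter of a Borel set $E\subset\mathbb{R}^2$ is \[ \mathrm{Per}_K(E) := \int_{\partial^* E} \Phi_K^\circ(\nu_E(x))\, d\mathcal{H}^{1}(x), \] where $\partial^*E$ is the reduced boundary of $E$, $\nu_E$ the measure-theoretic unit normal and $\mathcal{H}^1$ the one-dimensional Hausdorff measure (with the usual convention that the perimeter is $+\infty$ if $E$ does not have finite perimeter). Writing $|\cdot|$ for two-dimensional Lebesgue measure, the $K$-Cheeger constant of $\Omega$ is \[ h_K(\Omega) := \inf\left\{ \frac{\mathrm{Per}_K(E)}{|E|} : E \subset \Omega,\ |E|>0\right\}, \] and $\mathcal{J}_\Omega[K] := h_K(\Omega)\,|K^\circ|^{1/2}$. *)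

theory Defs
  imports "HOL-Analysis.Analysis"
begin

type_synonym plane = "real ^ 2"


definition sym_convex_bodies :: "plane set set" where
  "sym_convex_bodies =
     {K. K \<noteq> {} \<and> open K \<and> bounded K \<and> convex K \<and> (\<forall>x\<in>K. - x \<in> K)}"

definition polar :: "plane set \<Rightarrow> plane set" where
  "polar K = {x. \<forall>y\<in>K. x \<bullet> y < 1}"

definition polar_norm :: "plane set \<Rightarrow> plane \<Rightarrow> real" where
  "polar_norm K x = (SUP y\<in>K. x \<bullet> y)"


text \<open>
  The one-dimensional Hausdorff measure: covers by countably many sets of diameter at most
  \<open>\<delta>\<close>, then the supremum over \<open>\<delta>\<close>. In dimension one the normalising constant
  \<open>\<omega>\<^sub>1 / 2\<close> equals 1. Boundedness is required explicitly because \<^const>\<open>diameter\<close> is a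
  real number and carries no information on unbounded sets.
\<close>

definition hausdorff1_premeasure :: "real \<Rightarrow> plane set \<Rightarrow> ennreal" where
  "hausdorff1_premeasure \<delta> A =
     Inf {(\<Sum>i. ennreal (diameter (U i))) | U :: nat \<Rightarrow> plane set.
            A \<subseteq> (\<Union>i. U i) \<and> (\<forall>i. bounded (U i) \<and> diameter (U i) \<le> \<delta>)}"

definition hausdorff1_outer :: "plane set \<Rightarrow> ennreal" where
  "hausdorff1_outer A = (SUP \<delta>\<in>{0<..}. hausdorff1_premeasure \<delta> A)"

text \<open>
  The outer measure is a metric outer measure, hence countably additive on the Borel sets, so
  that \<^const>\<open>measure_of\<close> does not fall back to the null measure.
\<close>

definition hausdorff1 :: "plane measure" where
  "hausdorff1 = measure_of UNIV (sets borel) hausdorff1_outer"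


definition C1c_field :: "(plane \<Rightarrow> plane) \<Rightarrow> bool" where
  "C1c_field \<phi> \<longleftrightarrow>
     (\<forall>x. \<phi> differentiable (at x)) \<and>
     (\<forall>v. continuous_on UNIV (\<lambda>x. frechet_derivative \<phi> (at x) v)) \<and>
     compact (closure {x. \<phi> x \<noteq> 0})"

definition divergence :: "(plane \<Rightarrow> plane) \<Rightarrow> plane \<Rightarrow> real" where
  "divergence \<phi> x = (\<Sum>b\<in>Basis. frechet_derivative \<phi> (at x) b \<bullet> b)"

text \<open>
  An \<open>\<real>\<^sup>2\<close>-valued finite Radon measure is represented by its polar decomposition
  \<open>(\<mu>, \<sigma>)\<close>, that is, \<open>\<mu>\<close> is the total variation and \<open>\<sigma>\<close> a density of unit length. The
  predicate says that \<open>\<sigma> \<mu>\<close> is the Gauss--Green measure of \<open>E\<close>, i.e. minus the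
  distributional gradient of the indicator of \<open>E\<close>; with this sign the normal points outwards.
\<close>

definition gauss_green :: "plane set \<Rightarrow> plane measure \<Rightarrow> (plane \<Rightarrow> plane) \<Rightarrow> bool" where
  "gauss_green E \<mu> \<sigma> \<longleftrightarrow>
     finite_measure \<mu> \<and> sets \<mu> = sets borel \<and>
     \<sigma> \<in> borel_measurable borel \<and> (AE x in \<mu>. norm (\<sigma> x) = 1) \<and>
     (\<forall>\<phi>. C1c_field \<phi> \<longrightarrow>
        (LINT x:E|lborel. divergence \<phi> x) = (LINT x|\<mu>. \<phi> x \<bullet> \<sigma> x))"

text \<open>
  A set has finite perimeter if the distributional gradient of its indicator is a finite
  vector-valued Radon measure.
\<close>

definition finite_perimeter :: "plane set \<Rightarrow> bool" where
  "finite_perimeter E \<longleftrightarrow> E \<in> sets borel \<and> (\<exists>\<mu> \<sigma>. gauss_green E \<mu> \<sigma>)"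

text \<open>
  The total variation is unique and the density is unique almost everywhere, so the notions
  below do not depend on the choice made here.
\<close>

definition perimeter_measure :: "plane set \<Rightarrow> plane measure" where
  "perimeter_measure E = (SOME \<mu>. \<exists>\<sigma>. gauss_green E \<mu> \<sigma>)"

definition perimeter_density :: "plane set \<Rightarrow> plane \<Rightarrow> plane" where
  "perimeter_density E = (SOME \<sigma>. gauss_green E (perimeter_measure E) \<sigma>)"

definition mean_normal :: "plane set \<Rightarrow> plane \<Rightarrow> real \<Rightarrow> plane" where
  "mean_normal E x r =
     (LINT y:ball x r|perimeter_measure E. perimeter_density E y)
       /\<^sub>R measure (perimeter_measure E) (ball x r)"

definition reduced_boundary :: "plane set \<Rightarrow> plane set" where
  "reduced_boundary E =
     {x. (\<forall>r>0. measure (perimeter_measure E) (ball x r) > 0) \<and>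
         (\<exists>v. norm v = 1 \<and> (mean_normal E x \<longlongrightarrow> v) (at_right 0))}"

text \<open>Only meaningful on the reduced boundary.\<close>

definition unit_normal :: "plane set \<Rightarrow> plane \<Rightarrow> plane" where
  "unit_normal E x = Lim (at_right 0) (mean_normal E x)"

definition aniso_perimeter :: "plane set \<Rightarrow> plane set \<Rightarrow> ennreal" where
  "aniso_perimeter K E =
     (if finite_perimeter E
      then (\<integral>\<^sup>+x\<in>reduced_boundary E. ennreal (polar_norm K (unit_normal E x)) \<partial>hausdorff1)
      else \<infinity>)"


definition cheeger_const :: "plane set \<Rightarrow> plane set \<Rightarrow> ennreal" where
  "cheeger_const K \<Omega> =
     Inf {aniso_perimeter K E / emeasure lborel E | E.
            E \<in> sets borel \<and> E \<subseteq> \<Omega> \<and> emeasure lborel E > 0}"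

definition cheeger_functional :: "plane set \<Rightarrow> plane set \<Rightarrow> ennreal" where
  "cheeger_functional \<Omega> K =
     cheeger_const K \<Omega> * ennreal (sqrt (measure lborel (polar K)))"

end

theory Submission
  imports Defs "HOL-Complex_Analysis.Great_Picard"
begin

text \<open>
  The functional is invariant under scaling \<open>K\<close>, and \<open>s K \<subseteq> K' \<subseteq> a K\<close> implies
  \<open>J K' \<le> (a / s) J K\<close>. So a minimising sequence may be taken inside the unit ball and reaching
  norm \<open>1 / 2\<close>, and a limit of it is a minimiser as soon as the bodies do not collapse onto a
  segment. Collapse is excluded by the bound \<open>h\<^sub>K(\<Omega>) \<ge> c \<bar>y\<bar>\<close> for \<open>y \<in> K\<close>, with \<open>c > 0\<close> depending only
  on \<open>\<Omega>\<close>: it bounds the area of the polar body along the sequence, hence its diameter, hence the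
  inradius of \<open>K\<close> from below.

  For that bound, testing the Gauss--Green formula with \<open>x \<mapsto> (x \<bullet> e) e\<close>, cut off outside \<open>\<Omega>\<close>, gives
  \<open>\<bar>E\<bar> \<le> 2 R \<integral> \<bar>\<sigma> \<bullet> e\<bar> d\<mu>\<close> for the Gauss--Green measure \<open>\<sigma> \<mu>\<close>. It remains to dominate \<open>\<mu>\<close> by a
  multiple of the Hausdorff measure on the reduced boundary. By Besicovitch's covering theorem
  \<open>\<mu>\<close>-almost every point is a Lebesgue point of \<open>\<sigma>\<close>, hence lies in the reduced boundary with normal \<open>\<sigma>\<close>;
  testing with cutoffs of balls shows \<open>\<bar>\<sigma> \<mu> (B(x, r))\<bar> \<le> 8 \<pi> r\<close>, so \<open>\<mu>(B(x, r)) \<le> 16 \<pi> r\<close> at such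
  points for small \<open>r\<close>, and a covering argument concludes.
\<close>

section \<open>Hausdorff measure as a metric outer measure\<close>

text \<open>The perimeter integrates Hausdorff measure over the reduced boundary, whereas the
  Gauss--Green formula involves the abstract measure \<open>\<mu>\<close>. Identifying the two would
  be De Giorgi's structure theorem. Since only positivity of the Cheeger constant matters, and not
  its value, the single inequality \<open>\<mu>\<close> \<le> 16 pi H^1 off a
  \<open>\<mu>\<close>-null set suffices, with crude constants throughout. The covering theorem has
  to be Besicovitch's and not Vitali's because \<open>\<mu>\<close> is an arbitrary finite Borel
  measure without a doubling property. No compactness of sets E and no lower semicontinuity of the
  perimeter in E enter. Two bodies within a factor 1 + e of each other have values of the functional
  within a factor (1 + e)^2, whatever the near-optimal sets are, so the passage to the limit happens
  among the bodies alone. A recurring obstacle is measurability: neither the reduced boundary nor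
  the normal is shown to be Borel, so arguments pass to open covers, to complements of measurable
  null sets, or to simple functions below the integrand.\<close>

lemma metric_outer_measure_closed_le:
  fixes f :: "'a::metric_space set \<Rightarrow> ennreal"
  assumes oms: "outer_measure_space UNIV f"
    and metric: "\<And>A B d. 0 < d \<Longrightarrow> (\<And>a b. a \<in> A \<Longrightarrow> b \<in> B \<Longrightarrow> d \<le> dist a b) \<Longrightarrow> f A + f B \<le> f (A \<union> B)"
    and C: "closed C"
  shows "f (T \<inter> C) + f (T - C) \<le> f T"
proof (cases "C = {} \<or> f T = top")
  case True
  with oms show ?thesis by (auto simp: outer_measure_space_def positive_def)
next
  case False
  then have ne: "C \<noteq> {}" and fin: "f T < top" by (auto simp: less_top)
  have mono: "f A \<le> f B" if "A \<subseteq> B" for A B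
    using oms that by (auto simp: outer_measure_space_def increasing_def)
  have csub: "f (\<Union>i. A i) \<le> (\<Sum>i. f (A i))" if "disjoint_family A" for A :: "nat \<Rightarrow> 'a set"
    using oms that by (auto simp: outer_measure_space_def countably_subadditive_def)
  have sub2: "f (A \<union> B) \<le> f A + f B" for A B
  proof -
    interpret S: sigma_algebra UNIV "UNIV :: 'a set set"
      using sigma_algebra_Pow[of "UNIV :: 'a set"] by simp
    have "subadditive UNIV f"
      using oms S.countably_subadditive_subadditive by (simp add: outer_measure_space_def)
    then have "f (A \<union> (B - A)) \<le> f A + f (B - A)" unfolding subadditive_def by blast
    also have "\<dots> \<le> f A + f B" by (intro add_left_mono mono) auto
    finally show ?thesis by simp
  qed
  define g where "g x = infdist x C" for x
  have g_lip: "g x \<le> g y + dist x y" for x y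
    unfolding g_def using infdist_triangle[of x C y] by simp
  have g_pos: "g x > 0" if "x \<notin> C" for x
    using in_closed_iff_infdist_zero[OF C ne, of x] infdist_nonneg[of x C] that
    unfolding g_def by linarith
  define a where "a n = inverse (real (Suc n))" for n :: nat
  have a_less: "a m < a n" if "n < m" for m n
    using that by (simp add: a_def)
  have a_le: "a m \<le> a n" if "n \<le> m" for m n
    using that by (simp add: a_def)
  \<comment> \<open>Caratheodory's shells: \<open>W n\<close> stays at distance at least
    \<open>a n\<close> from C and exhausts T - C. Shells \<open>R n\<close> whose indices differ by
    at least two are separated, so the even ones and the odd ones each have total measure at most f
    T.\<close>
  define W where "W n = {x \<in> T. a n \<le> g x}" for n
  define R where "R n = W (Suc n) - W n" for n
  have sep: "(\<Sum>i<n. f (R (2 * i + p))) \<le> f (\<Union>i<n. R (2 * i + p))" for p n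
  proof (induction n)
    case 0 then show ?case by simp
  next
    case (Suc n)
    \<comment> \<open>For n = 0 the union to the left is empty and any positive d serves. The
      formula itself would give 0 at n = p = 0, where the subtraction on naturals is
      truncated.\<close>
    define d where "d = (if n = 0 then 1 else a (2 * n + p - 1) - a (2 * n + p))"
    have "0 < d" unfolding d_def using a_less[of "2 * n + p - 1" "2 * n + p"] by simp
    have dist: "d \<le> dist x y" if x: "x \<in> (\<Union>i<n. R (2 * i + p))" and y: "y \<in> R (2 * n + p)" for x y
    proof -
      from x obtain i where i: "i < n" "x \<in> R (2 * i + p)" by auto
      then have "a (Suc (2 * i + p)) \<le> g x" by (simp add: R_def W_def)
      moreover have "a (2 * n + p - 1) \<le> a (Suc (2 * i + p))" using i by (intro a_le) simp
      moreover have "g y < a (2 * n + p)" using y by (auto simp: R_def W_def)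
      moreover have "d = a (2 * n + p - 1) - a (2 * n + p)" using i by (simp add: d_def)
      ultimately show ?thesis using g_lip[of x y] by linarith
    qed
    have "(\<Sum>i<Suc n. f (R (2 * i + p))) \<le> f (\<Union>i<n. R (2 * i + p)) + f (R (2 * n + p))"
      using Suc by (simp add: add_right_mono)
    also have "\<dots> \<le> f ((\<Union>i<n. R (2 * i + p)) \<union> R (2 * n + p))"
      by (rule metric[OF \<open>0 < d\<close>]) (rule dist)
    also have "\<dots> = f (\<Union>i<Suc n. R (2 * i + p))" by (simp add: lessThan_Suc Un_commute)
    finally show ?case .
  qed
  have RT: "R n \<subseteq> T" for n by (auto simp: R_def W_def)
  have half: "(\<Sum>i<n. f (R (2 * i + p))) \<le> f T" for p n
    by (rule order_trans[OF sep mono]) (use RT in auto)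
  have tot: "(\<Sum>i<n. f (R i)) \<le> f T + f T" for n
  proof -
    have "(\<Sum>i<n. f (R i)) \<le> (\<Sum>i<2 * n. f (R i))" by (intro sum_mono2) auto
    also have "\<dots> = (\<Sum>i<n. f (R (2 * i + 0))) + (\<Sum>i<n. f (R (2 * i + 1)))"
      by (induction n) (simp_all add: algebra_simps)
    also have "\<dots> \<le> f T + f T" by (intro add_mono half)
    finally show ?thesis .
  qed
  define s where "s = (\<Sum>i. f (R i))"
  have "s \<le> f T + f T" unfolding s_def by (rule suminf_le_const[OF summableI tot])
  then have s_fin: "s \<noteq> top" using fin by (auto simp: top_unique)
  have Wsuc: "W n \<subseteq> W (Suc n)" for n
    unfolding W_def using a_le[of n "Suc n"] by auto
  have Wmono: "W m \<subseteq> W n" if "m \<le> n" for m n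
    using that by (rule lift_Suc_mono_le[of W, OF Wsuc])
  have disj: "disjoint_family R"
    unfolding R_def by (rule disjoint_family_Suc) (rule Wsuc)
  have cover: "T - C \<subseteq> W n \<union> (\<Union>i. R (i + n))" for n
  proof
    fix x assume x: "x \<in> T - C"
    then obtain m where m: "a m < g x"
      using reals_Archimedean[OF g_pos[of x]] unfolding a_def by auto
    show "x \<in> W n \<union> (\<Union>i. R (i + n))"
    proof (cases "x \<in> W n")
      case False
      define k where "k = (LEAST k. x \<in> W k)"
      have "x \<in> W m" using m x by (simp add: W_def)
      then have k: "x \<in> W k" unfolding k_def by (rule LeastI)
      have "n < k" using False k Wmono[of k n] by (meson in_mono not_less)
      then obtain j where j: "k = Suc j" "n \<le> j" by (cases k) auto
      have "x \<notin> W j" using not_less_Least[of j "\<lambda>k. x \<in> W k"] j unfolding k_def by auto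
      then have "x \<in> R ((j - n) + n)" using k j by (simp add: R_def)
      then show ?thesis by blast
    qed simp
  qed
  have gap: "f (T \<inter> C) + f (W n) \<le> f T" for n
  proof -
    have "f (T \<inter> C) + f (W n) \<le> f ((T \<inter> C) \<union> W n)"
    proof (rule metric[of "a n"])
      show "0 < a n" by (simp add: a_def)
      fix x y assume "x \<in> T \<inter> C" "y \<in> W n"
      then have "a n \<le> g y" "g y \<le> dist y x"
        by (auto simp: W_def g_def intro: infdist_le)
      then show "a n \<le> dist x y" by (simp add: dist_commute)
    qed
    also have "\<dots> \<le> f T" by (intro mono) (auto simp: W_def)
    finally show ?thesis .
  qed
  \<comment> \<open>Instead of letting the tails of the shell series tend to 0, the finite total s
    is added on both sides, assembled from partial sum and tail, and cancelled at the end.\<close>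
  have "s + (f (T \<inter> C) + f (T - C)) \<le> f T + s"
    unfolding s_def
  proof (rule ennreal_suminf_bound_add)
    fix n
    have "f (T - C) \<le> f (W n) + f (\<Union>i. R (i + n))"
      by (rule order_trans[OF mono[OF cover] sub2])
    also have "f (\<Union>i. R (i + n)) \<le> (\<Sum>i. f (R (i + n)))"
      by (rule csub) (use disj in \<open>auto simp: disjoint_family_on_def\<close>)
    finally have 1: "f (T - C) \<le> f (W n) + (\<Sum>i. f (R (i + n)))" by (simp add: add_left_mono)
    have "(\<Sum>i<n. f (R i)) + (f (T \<inter> C) + f (T - C))
        \<le> (\<Sum>i<n. f (R i)) + (f (T \<inter> C) + (f (W n) + (\<Sum>i. f (R (i + n)))))"
      by (intro add_left_mono 1)
    also have "\<dots> = (f (T \<inter> C) + f (W n)) + ((\<Sum>i. f (R (i + n))) + (\<Sum>i<n. f (R i)))"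
      by (simp add: ac_simps)
    also have "(\<Sum>i. f (R (i + n))) + (\<Sum>i<n. f (R i)) = (\<Sum>i. f (R i))"
      by (rule suminf_offset[symmetric]) (rule summableI)
    also have "(f (T \<inter> C) + f (W n)) + \<dots> \<le> f T + \<dots>" by (intro add_right_mono gap)
    finally show "(\<Sum>i<n. f (R i)) + (f (T \<inter> C) + f (T - C)) \<le> f T + (\<Sum>i. f (R i))" .
  qed
  then have "s + (f (T \<inter> C) + f (T - C)) \<le> s + f T" by (simp only: add.commute)
  then show ?thesis
    using s_fin by (simp only: ennreal_add_left_cancel_le) simp
qed

text \<open>Caratheodory's criterion: f is a measure on its \<open>lambda_system\<close>, which is a
  sigma-algebra and contains the closed sets by the preceding lemma and subadditivity.\<close>

lemma metric_outer_measure_space_borel: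
  fixes f :: "'a::metric_space set \<Rightarrow> ennreal"
  assumes oms: "outer_measure_space UNIV f"
    and metric: "\<And>A B d. 0 < d \<Longrightarrow> (\<And>a b. a \<in> A \<Longrightarrow> b \<in> B \<Longrightarrow> d \<le> dist a b) \<Longrightarrow> f A + f B \<le> f (A \<union> B)"
  shows "measure_space UNIV (sets borel) f"
proof -
  interpret S: sigma_algebra UNIV "UNIV :: 'a set set"
    using sigma_algebra_Pow[of "UNIV :: 'a set"] by simp
  define L where "L = lambda_system UNIV UNIV f"
  have ms: "measure_space UNIV L f"
    unfolding L_def by (rule S.caratheodory_lemma[OF oms])
  then interpret L: sigma_algebra UNIV L by (simp add: measure_space_def)
  have "subadditive UNIV f"
    using oms S.countably_subadditive_subadditive by (simp add: outer_measure_space_def)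
  then have sub2: "f T \<le> f (T \<inter> C) + f (T - C)" for T C
    unfolding subadditive_def by (metis Int_Diff_Un Int_Diff_disjoint UNIV_I)
  have "{C. closed C} \<subseteq> L"
    unfolding L_def S.lambda_system_eq
    using metric_outer_measure_closed_le[OF oms metric] sub2 by (auto intro!: antisym)
  then have "sigma_sets UNIV {C. closed C} \<subseteq> L" by (rule L.sigma_sets_subset)
  then have "sets (borel :: 'a measure) \<subseteq> L"
    by (simp add: borel_eq_closed)
  then show ?thesis
    using ms sets.sigma_algebra_axioms[of "borel :: 'a measure"]
    by (auto intro: measure_down)
qed

section \<open>Hausdorff premeasures and their additivity on separated sets\<close>

lemma hausdorff1_premeasure_le:
  assumes "A \<subseteq> (\<Union>i. U i)" "\<And>i. bounded (U i)" "\<And>i. diameter (U i) \<le> \<delta>"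
  shows "hausdorff1_premeasure \<delta> A \<le> (\<Sum>i. ennreal (diameter (U i)))"
  unfolding hausdorff1_premeasure_def using assms by (intro Inf_lower) auto

lemma hausdorff1_premeasure_cover:
  assumes "hausdorff1_premeasure \<delta> A < c"
  obtains U where "A \<subseteq> (\<Union>i. U i)" "\<And>i. bounded (U i)" "\<And>i. diameter (U i) \<le> \<delta>"
    "(\<Sum>i. ennreal (diameter (U i))) < c"
  using assms unfolding hausdorff1_premeasure_def Inf_less_iff by auto

lemma hausdorff1_premeasure_mono:
  "A \<subseteq> B \<Longrightarrow> hausdorff1_premeasure \<delta> A \<le> hausdorff1_premeasure \<delta> B"
  unfolding hausdorff1_premeasure_def by (intro Inf_superset_mono) blast

lemma hausdorff1_premeasure_antimono:
  "\<delta> \<le> \<delta>' \<Longrightarrow> hausdorff1_premeasure \<delta>' A \<le> hausdorff1_premeasure \<delta> A"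
  unfolding hausdorff1_premeasure_def by (intro Inf_superset_mono) (auto intro: order_trans)

lemma hausdorff1_premeasure_subadditive:
  "hausdorff1_premeasure \<delta> (\<Union>n. A n) \<le> (\<Sum>n. hausdorff1_premeasure \<delta> (A n))"
proof (rule ennreal_le_epsilon)
  fix e :: real
  let ?h = "hausdorff1_premeasure \<delta>"
  assume "0 < e" "(\<Sum>n. ?h (A n)) < top"
  then have *: "?h (A n) < ?h (A n) + e * (1/2)^Suc n" for n
    by (auto simp add: less_top dest!: ennreal_suminf_lessD)
  have "\<exists>U. A n \<subseteq> (\<Union>i. U i) \<and> (\<forall>i. bounded (U i)) \<and> (\<forall>i. diameter (U i) \<le> \<delta>) \<and>
    (\<Sum>i. ennreal (diameter (U i))) \<le> ?h (A n) + e * (1/2)^Suc n" for n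
    by (rule hausdorff1_premeasure_cover[OF *[of n]]) (metis less_imp_le)
  then obtain U where U: "\<And>n. A n \<subseteq> (\<Union>i. U n i)" "\<And>n i. bounded (U n i)"
    "\<And>n i. diameter (U n i) \<le> \<delta>"
    "\<And>n. (\<Sum>i. ennreal (diameter (U n i))) \<le> ?h (A n) + e * (1/2)^Suc n"
    by metis
  define V where "V k = (case prod_decode k of (n, i) \<Rightarrow> U n i)" for k
  have "(\<Union>n. A n) \<subseteq> (\<Union>k. V k)"
  proof
    fix x assume "x \<in> (\<Union>n. A n)"
    then obtain n i where "x \<in> U n i" using U(1) by blast
    then have "x \<in> V (prod_encode (n, i))" by (simp add: V_def)
    then show "x \<in> (\<Union>k. V k)" by blast
  qed
  then have "?h (\<Union>n. A n) \<le> (\<Sum>k. ennreal (diameter (V k)))"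
    by (rule hausdorff1_premeasure_le) (auto simp: V_def U split: prod.split)
  also have "\<dots> = (\<Sum>k. (\<lambda>(n, i). ennreal (diameter (U n i))) (prod_decode k))"
    by (simp add: V_def case_prod_unfold)
  also have "\<dots> = (\<Sum>n. \<Sum>i. ennreal (diameter (U n i)))"
    by (intro suminf_ennreal_2dimen) auto
  also have "\<dots> \<le> (\<Sum>n. ?h (A n) + e * (1/2) ^ Suc n)"
    by (intro suminf_le U(4)) auto
  also have "\<dots> = (\<Sum>n. ?h (A n)) + (\<Sum>n. ennreal e * ennreal ((1/2) ^ Suc n))"
    using \<open>0 < e\<close> by (subst suminf_add[symmetric])
      (auto simp del: ennreal_suminf_cmult simp add: ennreal_mult[symmetric])
  also have "\<dots> = (\<Sum>n. ?h (A n)) + e"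
    unfolding ennreal_suminf_cmult
    by (subst suminf_ennreal_eq[OF zero_le_power power_half_series]) auto
  finally show "?h (\<Union>n. A n) \<le> (\<Sum>n. ?h (A n)) + e" .
qed

text \<open>A covering set of diameter below d cannot meet both A and B, so every cover of the union
  splits into a cover of A and a cover of B.\<close>

lemma hausdorff1_premeasure_add_separated:
  assumes "\<delta> < d" and sep: "\<And>a b. a \<in> A \<Longrightarrow> b \<in> B \<Longrightarrow> d \<le> dist a b" and "0 < \<delta>"
  shows "hausdorff1_premeasure \<delta> A + hausdorff1_premeasure \<delta> B \<le> hausdorff1_premeasure \<delta> (A \<union> B)"
proof (rule ccontr)
  assume "\<not> ?thesis"
  then have "hausdorff1_premeasure \<delta> (A \<union> B) < hausdorff1_premeasure \<delta> A + hausdorff1_premeasure \<delta> B"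
    by simp
  then obtain U where U: "A \<union> B \<subseteq> (\<Union>i. U i)" "\<And>i. bounded (U i)" "\<And>i. diameter (U i) \<le> \<delta>"
    and lt: "(\<Sum>i. ennreal (diameter (U i))) < hausdorff1_premeasure \<delta> A + hausdorff1_premeasure \<delta> B"
    by (rule hausdorff1_premeasure_cover) blast
  define V where "V S i = (if U i \<inter> S = {} then {} else U i)" for S i
  have V: "hausdorff1_premeasure \<delta> S \<le> (\<Sum>i. ennreal (diameter (V S i)))" if "S \<subseteq> A \<union> B" for S
    by (rule hausdorff1_premeasure_le) (use U that \<open>0 < \<delta>\<close> in \<open>fastforce simp: V_def\<close>)+
  have "U i \<inter> A = {} \<or> U i \<inter> B = {}" for i
  proof (rule ccontr)
    assume "\<not> (U i \<inter> A = {} \<or> U i \<inter> B = {})"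
    then obtain a b where "a \<in> U i" "b \<in> U i" "a \<in> A" "b \<in> B" by blast
    then show False
      using sep[of a b] diameter_bounded_bound[OF U(2), of a i b] U(3)[of i] \<open>\<delta> < d\<close> by linarith
  qed
  then have *: "ennreal (diameter (V A i)) + ennreal (diameter (V B i)) \<le> ennreal (diameter (U i))" for i
    by (auto simp: V_def)
  have "hausdorff1_premeasure \<delta> A + hausdorff1_premeasure \<delta> B
      \<le> (\<Sum>i. ennreal (diameter (V A i))) + (\<Sum>i. ennreal (diameter (V B i)))"
    by (intro add_mono V) auto
  also have "\<dots> = (\<Sum>i. ennreal (diameter (V A i)) + ennreal (diameter (V B i)))"
    by (rule suminf_add) (rule summableI)+
  also have "\<dots> \<le> (\<Sum>i. ennreal (diameter (U i)))"
    by (intro suminf_le * summableI)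
  finally show False using lt by simp
qed

lemma hausdorff1_premeasure_le_outer:
  "0 < \<delta> \<Longrightarrow> hausdorff1_premeasure \<delta> A \<le> hausdorff1_outer A"
  unfolding hausdorff1_outer_def by (intro SUP_upper) auto

lemma hausdorff1_outer_measure_space: "outer_measure_space UNIV hausdorff1_outer"
proof -
  have "hausdorff1_premeasure \<delta> {} = 0" if "0 < \<delta>" for \<delta>
    using hausdorff1_premeasure_le[of "{}" "\<lambda>_. {}" \<delta>] that by simp
  then have "hausdorff1_outer {} = 0"
    by (auto simp: hausdorff1_outer_def intro!: antisym SUP_least)
  moreover have "hausdorff1_outer A \<le> hausdorff1_outer B" if "A \<subseteq> B" for A B
    unfolding hausdorff1_outer_def by (intro SUP_mono') (rule hausdorff1_premeasure_mono[OF that])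
  moreover have "hausdorff1_outer (\<Union>n. A n) \<le> (\<Sum>n. hausdorff1_outer (A n))" for A :: "nat \<Rightarrow> plane set"
  proof -
    have "hausdorff1_premeasure \<delta> (\<Union>n. A n) \<le> (\<Sum>n. hausdorff1_outer (A n))" if "0 < \<delta>" for \<delta>
      by (rule order_trans[OF hausdorff1_premeasure_subadditive])
        (intro suminf_le summableI hausdorff1_premeasure_le_outer that)
    then show ?thesis
      by (subst hausdorff1_outer_def) (auto intro: SUP_least)
  qed
  ultimately show ?thesis
    by (auto simp: outer_measure_space_def positive_def increasing_def countably_subadditive_def)
qed

lemma hausdorff1_outer_add_separated:
  assumes "0 < d" and sep: "\<And>a b. a \<in> A \<Longrightarrow> b \<in> B \<Longrightarrow> d \<le> dist a b"
  shows "hausdorff1_outer A + hausdorff1_outer B \<le> hausdorff1_outer (A \<union> B)"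
proof -
  have "hausdorff1_premeasure s A + hausdorff1_premeasure t B \<le> hausdorff1_outer (A \<union> B)"
    if "0 < s" "0 < t" for s t
  proof -
    \<comment> \<open>The two suprema run over independent scales s and t. Passing to a common scale
      below d only increases both premeasures.\<close>
    define m where "m = min (min s t) (d / 2)"
    have m: "0 < m" "m \<le> s" "m \<le> t" "m < d" using that \<open>0 < d\<close> by (auto simp: m_def)
    have "hausdorff1_premeasure s A + hausdorff1_premeasure t B
        \<le> hausdorff1_premeasure m A + hausdorff1_premeasure m B"
      using m by (intro add_mono hausdorff1_premeasure_antimono)
    also have "\<dots> \<le> hausdorff1_premeasure m (A \<union> B)"
      by (rule hausdorff1_premeasure_add_separated[OF m(4) sep m(1)])
    also have "\<dots> \<le> hausdorff1_outer (A \<union> B)"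
      by (rule hausdorff1_premeasure_le_outer[OF m(1)])
    finally show ?thesis .
  qed
  then have "(SUP s\<in>{0<..}. hausdorff1_premeasure s A + hausdorff1_premeasure t B) \<le> hausdorff1_outer (A \<union> B)"
    if "0 < t" for t
    using that by (intro SUP_least) auto
  then have "hausdorff1_outer A + hausdorff1_premeasure t B \<le> hausdorff1_outer (A \<union> B)" if "0 < t" for t
    using that by (subst (asm) ennreal_SUP_add_left) (auto simp: hausdorff1_outer_def greaterThan_non_empty)
  then have "(SUP t\<in>{0<..}. hausdorff1_outer A + hausdorff1_premeasure t B) \<le> hausdorff1_outer (A \<union> B)"
    by (intro SUP_least) auto
  also have "(SUP t\<in>{0<..}. hausdorff1_outer A + hausdorff1_premeasure t B) =
      hausdorff1_outer A + hausdorff1_outer B"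
    unfolding hausdorff1_outer_def[of B] by (intro ennreal_SUP_add_right[symmetric]) auto
  finally show ?thesis .
qed

lemma sets_hausdorff1 [simp, measurable_cong]: "sets hausdorff1 = sets borel"
  unfolding hausdorff1_def using sets.sigma_algebra_axioms[of "borel :: plane measure"]
  by (simp add: sets_measure_of sigma_algebra.sigma_sets_eq)

lemma emeasure_hausdorff1:
  assumes "B \<in> sets borel"
  shows "emeasure hausdorff1 B = hausdorff1_outer B"
proof -
  have "measure_space UNIV (sets borel) hausdorff1_outer"
    by (rule metric_outer_measure_space_borel[OF hausdorff1_outer_measure_space])
      (rule hausdorff1_outer_add_separated)
  then show ?thesis
    unfolding hausdorff1_def using assms
    by (intro emeasure_measure_of_sigma) (auto simp: measure_space_def)
qed

section \<open>Besicovitch covering and Lebesgue points\<close>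

text \<open>The greedy algorithm as a well-founded recursion: x is kept unless an earlier kept y
  blocks it. This form handles uncountably many candidates.\<close>

lemma greedy_selection:
  assumes "wf R"
  obtains S where "\<And>x. x \<in> S \<longleftrightarrow> (\<forall>y. (y, x) \<in> R \<longrightarrow> y \<in> S \<longrightarrow> \<not> P y x)"
proof
  define S where "S = {x. wfrec R (\<lambda>f x. \<forall>y. (y, x) \<in> R \<longrightarrow> f y \<longrightarrow> \<not> P y x) x}"
  show "x \<in> S \<longleftrightarrow> (\<forall>y. (y, x) \<in> R \<longrightarrow> y \<in> S \<longrightarrow> \<not> P y x)" for x
    unfolding S_def mem_Collect_eq
    by (subst wfrec[OF assms]) (simp add: cut_apply)
qed

lemma exists_level:
  fixes r q :: real
  assumes "0 < r" "r \<le> 1" "0 < q" "q < 1"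
  shows "\<exists>k::nat. q ^ Suc k < r \<and> r \<le> q ^ k"
proof -
  obtain n where n: "q ^ n < r" using real_arch_pow_inv[of r q] assms by auto
  define m where "m = (LEAST n. q ^ n < r)"
  have m: "q ^ m < r" unfolding m_def by (rule LeastI[of "\<lambda>n. q ^ n < r", OF n])
  then obtain k where k: "m = Suc k" using assms by (cases m) auto
  then have "\<not> q ^ k < r" using not_less_Least[of k "\<lambda>n. q ^ n < r"] unfolding m_def by auto
  then show ?thesis using m k by auto
qed

text \<open>Sorting centres by decreasing radius is not well-founded, so radii are grouped into
  levels between \<open>q ^ Suc k\<close> and \<open>q ^ k\<close>, with an arbitrary well-order
  inside each level. An earlier centre then has radius at least q times that of a later one, and a
  selected later centre lies outside the earlier ball.\<close>

lemma besicovitch_selection: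
  fixes r :: "'a::metric_space \<Rightarrow> real"
  assumes r: "\<And>x. x \<in> A \<Longrightarrow> 0 < r x \<and> r x \<le> 1" and q: "0 < q" "q < 1"
  obtains S where "S \<subseteq> A" "A \<subseteq> (\<Union>x\<in>S. ball x (r x))"
    "\<And>x y. x \<in> S \<Longrightarrow> y \<in> S \<Longrightarrow> x \<noteq> y \<Longrightarrow>
       (r x \<le> dist x y \<and> q * r y \<le> r x) \<or> (r y \<le> dist x y \<and> q * r x \<le> r y)"
proof -
  have "\<exists>l. \<forall>x\<in>A. q ^ Suc (l x) < r x \<and> r x \<le> q ^ l x"
    using exists_level[OF _ _ q] r by (intro bchoice) blast
  then obtain l where l: "\<And>x. x \<in> A \<Longrightarrow> q ^ Suc (l x) < r x \<and> r x \<le> q ^ l x" by blast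
  obtain W :: "'a rel" where W: "well_order_on UNIV W" using well_order_on by blast
  then have wfW: "wf (W - Id)" and tot: "\<And>x y. x \<noteq> y \<Longrightarrow> (x, y) \<in> W \<or> (y, x) \<in> W"
    by (auto simp: well_order_on_def linear_order_on_def total_on_def)
  define R where "R = inv_image (less_than <*lex*> (W - Id)) (\<lambda>x. (l x, x))"
  have "wf R" unfolding R_def using wfW by (intro wf_inv_image wf_lex_prod) auto
  \<comment> \<open>The recursion runs over the whole type. Points outside A never block, and
    \<open>S \<inter> A\<close> is the selection.\<close>
  obtain S where S: "\<And>x. x \<in> S \<longleftrightarrow>
      (\<forall>y. (y, x) \<in> R \<longrightarrow> y \<in> S \<longrightarrow> \<not> (y \<in> A \<and> x \<in> ball y (r y)))"
    by (rule greedy_selection[OF \<open>wf R\<close>, of "\<lambda>y x. y \<in> A \<and> x \<in> ball y (r y)"]) blast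
  have key: "r x \<le> dist x y \<and> q * r y \<le> r x" if "x \<in> S \<inter> A" "y \<in> S \<inter> A" "(x, y) \<in> R" for x y
  proof
    show "r x \<le> dist x y" using S[of y] that by auto
    have "l x \<le> l y" using that(3) by (auto simp: R_def)
    then have "q ^ l y \<le> q ^ l x" using q by (intro power_decreasing) auto
    then have "r y \<le> q ^ l x" using l[of y] that by force
    then have "q * r y \<le> q * q ^ l x" using q by simp
    then show "q * r y \<le> r x" using l[of x] that by simp
  qed
  have totR: "(x, y) \<in> R \<or> (y, x) \<in> R" if "x \<noteq> y" for x y
    using tot[OF that] that by (auto simp: R_def)
  show ?thesis
  proof
    show "S \<inter> A \<subseteq> A" by simp
    show "A \<subseteq> (\<Union>x\<in>S \<inter> A. ball x (r x))"
    proof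
      fix x assume "x \<in> A"
      show "x \<in> (\<Union>x\<in>S \<inter> A. ball x (r x))"
      proof (cases "x \<in> S")
        case True then show ?thesis using \<open>x \<in> A\<close> r[of x] by force
      next
        case False then show ?thesis using S[of x] by blast
      qed
    qed
    show "(r x \<le> dist x y \<and> q * r y \<le> r x) \<or> (r y \<le> dist x y \<and> q * r x \<le> r y)"
      if "x \<in> S \<inter> A" "y \<in> S \<inter> A" "x \<noteq> y" for x y
      using totR[OF that(3)] key[OF that(1,2)] key[OF that(2,1)] by (auto simp: dist_commute)
  qed
qed

section \<open>Bounded overlap of the selected balls in the plane\<close>

definition octant :: "plane \<Rightarrow> bool \<times> bool \<times> bool" where
  "octant v = (0 \<le> v $ 1, 0 \<le> v $ 2, \<bar>v $ 1\<bar> \<le> \<bar>v $ 2\<bar>)"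

lemma inner_plane: "(a :: plane) \<bullet> b = a $ 1 * b $ 1 + a $ 2 * b $ 2"
  by (simp add: inner_vec_def sum_2)

lemma norm_plane: "norm (a :: plane) ^ 2 = (a $ 1) ^ 2 + (a $ 2) ^ 2"
  unfolding power2_norm_eq_inner inner_plane by (simp add: power2_eq_square)

text \<open>Vectors in a common octant enclose an angle of at most 45 degrees, and
  \<open>7 / 10 < cos 45\<close>.\<close>

lemma octant_inner_real:
  fixes a b c d :: real
  assumes "0 \<le> a" "a \<le> b" "0 \<le> c" "c \<le> d"
  shows "(a^2 + b^2) * (c^2 + d^2) \<le> 2 * (a * c + b * d)^2"
proof -
  have "2 * (a * c + b * d)^2 - (a^2 + b^2) * (c^2 + d^2) =
      a^2 * c^2 + 4 * (a * c) * (b * d) + b^2 * d^2 - a^2 * d^2 - b^2 * c^2"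
    by (simp add: power2_eq_square algebra_simps)
  also have "\<dots> = (b^2 - a^2) * (d^2 - c^2) + 4 * (a * c) * (b * d)"
    by (simp add: algebra_simps)
  also have "\<dots> \<ge> 0"
    using assms by (intro add_nonneg_nonneg mult_nonneg_nonneg) (auto intro: power_mono)
  finally show ?thesis by simp
qed

lemma octant_inner:
  fixes a b :: plane
  assumes "octant a = octant b"
  shows "7 / 10 * (norm a * norm b) \<le> a \<bullet> b"
proof -
  let ?a = "\<lambda>i. \<bar>a $ i\<bar>" and ?b = "\<lambda>i. \<bar>b $ i\<bar>"
  have "a $ 1 * b $ 1 = ?a 1 * ?b 1" "a $ 2 * b $ 2 = ?a 2 * ?b 2"
    using assms by (auto simp: octant_def abs_if mult_nonneg_nonneg)
  then have inn: "a \<bullet> b = ?a 1 * ?b 1 + ?a 2 * ?b 2" by (simp add: inner_plane)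
  then have "0 \<le> a \<bullet> b" by simp
  have "(norm a * norm b)^2 = (?a 1 ^2 + ?a 2 ^2) * (?b 1 ^2 + ?b 2 ^2)"
    by (simp add: power_mult_distrib norm_plane)
  also have "\<dots> \<le> 2 * (a \<bullet> b)^2"
  proof (cases "?a 1 \<le> ?a 2")
    case True
    then have "?b 1 \<le> ?b 2" using assms by (auto simp: octant_def)
    with True show ?thesis unfolding inn by (intro octant_inner_real) auto
  next
    case False
    then have "?b 2 \<le> ?b 1" "?a 2 \<le> ?a 1" using assms by (auto simp: octant_def)
    then show ?thesis
      using octant_inner_real[of "?a 2" "?a 1" "?b 2" "?b 1"] unfolding inn by (simp add: ac_simps)
  qed
  finally have "(norm a * norm b)^2 \<le> 2 * (a \<bullet> b)^2" .
  moreover have "(7 / 10 * (norm a * norm b))^2 = 49 / 100 * (norm a * norm b)^2"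
    by (simp only: power_mult_distrib[of "7 / 10"]) (simp add: power_divide)
  ultimately have "(7 / 10 * (norm a * norm b))^2 \<le> (a \<bullet> b)^2"
    using zero_le_power2[of "norm a * norm b"] by linarith
  then show ?thesis using \<open>0 \<le> a \<bullet> b\<close> by (rule power2_le_imp_le)
qed

text \<open>The law of cosines with 2 cos 45 > 14 / 10. The factor 9 / 10 is the ratio q of the
  greedy selection, and 3 / 10 is this ratio times the threshold 1 / 3 that defines a close centre
  in \<open>besicovitch_overlap\<close>.\<close>

lemma octant_dist:
  fixes a b :: plane
  assumes "octant a = octant b" "norm b \<le> norm a" "b \<noteq> 0"
  shows "norm (a - b) < norm a" "norm a * 3 / 10 \<le> norm b \<Longrightarrow> norm (a - b) < norm a * 9 / 10"
proof -
  define s t where "s = norm a" and "t = norm b"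
  have st: "0 < t" "t \<le> s" using assms by (auto simp: s_def t_def)
  have "norm (a - b)^2 = s^2 + t^2 - 2 * (a \<bullet> b)"
    unfolding s_def t_def by (simp add: power2_norm_eq_inner algebra_simps inner_commute)
  also have "\<dots> \<le> s^2 + t^2 - 14 / 10 * (s * t)"
    using octant_inner[OF assms(1)] by (simp add: s_def t_def)
  finally have *: "norm (a - b)^2 \<le> s^2 + t^2 - 14 / 10 * (s * t)" .
  have "t * t \<le> s * t" using st by (intro mult_right_mono) auto
  moreover have "0 < s * t" using st by simp
  ultimately have "norm (a - b)^2 < s^2" using * by (simp add: power2_eq_square)
  then show "norm (a - b) < norm a" unfolding s_def by (rule power2_less_imp_less) simp
  assume "norm a * 3 / 10 \<le> norm b"
  then have "3 / 10 * s \<le> t" by (simp add: s_def t_def)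
  \<comment> \<open>t lies between the roots of this quadratic, which bounds t^2 by an expression
    linear in t.\<close>
  then have "(t - 3 / 10 * s) * (t - s) \<le> 0" using st by (intro mult_nonneg_nonpos) auto
  moreover have "(t - 3 / 10 * s) * (t - s) = t^2 - 13 / 10 * (s * t) + 3 / 10 * s^2"
    by (simp add: power2_eq_square field_simps)
  ultimately have "s^2 + t^2 - 14 / 10 * (s * t) \<le> s^2 * 7 / 10 - s * t / 10" by linarith
  also have "\<dots> < 81 / 100 * s^2" using \<open>0 < s * t\<close> zero_le_power2[of s] by linarith
  also have "\<dots> = (s * 9 / 10)^2" by (simp add: power_mult_distrib power_divide)
  finally have "norm (a - b)^2 < (s * 9 / 10)^2" using * by simp
  then show "norm (a - b) < norm a * 9 / 10" unfolding s_def by (rule power2_less_imp_less) simp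
qed

text \<open>Around a common point \<open>z\<close>, each octant contains at most one centre that is not close to
  \<open>z\<close> relative to its radius, and at most one centre is close.\<close>

lemma besicovitch_overlap:
  fixes r :: "plane \<Rightarrow> real"
  assumes r: "\<And>x. x \<in> S \<Longrightarrow> 0 < r x"
    and sep: "\<And>x y. x \<in> S \<Longrightarrow> y \<in> S \<Longrightarrow> x \<noteq> y \<Longrightarrow>
       (r x \<le> dist x y \<and> 9 / 10 * r y \<le> r x) \<or> (r y \<le> dist x y \<and> 9 / 10 * r x \<le> r y)"
  shows "finite {x \<in> S. z \<in> ball x (r x)} \<and> card {x \<in> S. z \<in> ball x (r x)} \<le> 9"
proof -
  define X where "X = {x \<in> S. z \<in> ball x (r x)}"
  define Y where "Y = {x \<in> X. r x / 3 \<le> norm (x - z)}"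
  have X: "norm (x - z) < r x" "x \<in> S" "0 < r x" if "x \<in> X" for x
    using that r by (auto simp: X_def dist_norm)
  have inj: "inj_on (\<lambda>x. octant (x - z)) Y"
  proof (rule ccontr)
    assume "\<not> ?thesis"
    then obtain x y where xy: "x \<in> Y" "y \<in> Y" "x \<noteq> y" "octant (x - z) = octant (y - z)"
        "norm (y - z) \<le> norm (x - z)"
      unfolding inj_on_def by (metis linear)
    have XY: "x \<in> X" "y \<in> X" "r y / 3 \<le> norm (y - z)" using xy by (auto simp: Y_def)
    have y0: "y - z \<noteq> 0" using XY X(3)[of y] by auto
    have d: "norm ((x - z) - (y - z)) = dist x y" by (simp add: dist_norm)
    show False
      \<comment> \<open>x is the centre farther from z. In the first case dist x y < norm (x - z) <
        r x; in the second dist x y < 9 / 10 * norm (x - z) < 9 / 10 * r x \<le> r y. Both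
        contradict the separation.\<close>
      using sep[OF X(2) X(2) xy(3), OF XY(1,2)]
    proof
      assume "r x \<le> dist x y \<and> 9 / 10 * r y \<le> r x"
      then show False using octant_dist(1)[OF xy(4,5) y0] X(1)[OF XY(1)] d by linarith
    next
      assume *: "r y \<le> dist x y \<and> 9 / 10 * r x \<le> r y"
      then have "norm (x - z) * 3 / 10 \<le> norm (y - z)"
        using XY(3) X(1)[OF XY(1)] by linarith
      then show False using octant_dist(2)[OF xy(4,5) y0] X(1)[OF XY(1)] d * by linarith
    qed
  qed
  have finY: "finite Y" by (rule inj_on_finite[OF inj subset_UNIV]) simp
  \<comment> \<open>The codomain of \<open>octant\<close> has 8 elements; the one possible close
    centre makes 9.\<close>
  have "card Y \<le> card (UNIV :: (bool \<times> bool \<times> bool) set)"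
    by (rule card_inj_on_le[OF inj]) auto
  also have "\<dots> = 8" by (simp add: card_UNIV_bool)
  finally have cardY: "card Y \<le> 8" .
  \<comment> \<open>Two close centres are at distance below (r x + r y) / 3. As the radii are
    comparable up to 9 / 10, this is less than the radius that \<open>sep\<close> makes a lower
    bound for the distance.\<close>
  have one: "x = y" if "x \<in> X - Y" "y \<in> X - Y" for x y
  proof (rule ccontr)
    assume "x \<noteq> y"
    have "norm (x - z) < r x / 3" "norm (y - z) < r y / 3" using that by (auto simp: Y_def)
    moreover have "dist x y \<le> norm (x - z) + norm (y - z)"
      using norm_triangle_ineq4[of "x - z" "y - z"] by (simp add: dist_norm)
    ultimately show False
      using sep[OF X(2) X(2) \<open>x \<noteq> y\<close>] X(3)[of x] X(3)[of y] that by fastforce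
  qed
  have fin1: "finite (X - Y)" and card1: "card (X - Y) \<le> 1"
  proof -
    have "\<exists>c. X - Y \<subseteq> {c}" using one by blast
    then obtain c where "X - Y \<subseteq> {c}" by blast
    then show "finite (X - Y)" "card (X - Y) \<le> 1"
      using card_mono[of "{c}" "X - Y"] by (auto intro: finite_subset)
  qed
  have "X = Y \<union> (X - Y)" by (auto simp: Y_def)
  then have "finite X" "card X \<le> card Y + card (X - Y)"
    using finY fin1 by (metis finite_UnI, metis card_Un_le)
  then show ?thesis using cardY card1 by (simp add: X_def)
qed

text \<open>Integrating the overlap: the traces on D of the selected balls cover each point at most
  9 times, and by \<open>large\<close> each ball has measure at most 1 / c times that of its trace.
  The set A may be non-measurable, hence the open G.\<close>

lemma besicovitch_measure_bound:
  fixes \<mu> :: "plane measure" and r :: "plane \<Rightarrow> real"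
  assumes fin: "finite_measure \<mu>" and sets: "sets \<mu> = sets borel" and D: "D \<in> sets borel"
    and r: "\<And>x. x \<in> A \<Longrightarrow> 0 < r x \<and> r x \<le> 1" and "0 < c"
    and large: "\<And>x. x \<in> A \<Longrightarrow> c * measure \<mu> (ball x (r x)) \<le> measure \<mu> (D \<inter> ball x (r x))"
  obtains G where "open G" "A \<subseteq> G" "measure \<mu> G \<le> 9 / c * measure \<mu> D"
proof -
  interpret finite_measure \<mu> by fact
  have spc: "space \<mu> = UNIV" using sets_eq_imp_space_eq[OF sets] by simp
  have [measurable]: "D \<in> sets \<mu>" "\<And>x s. ball x s \<in> sets \<mu>" using D sets by auto
  obtain S where S: "S \<subseteq> A" "A \<subseteq> (\<Union>x\<in>S. ball x (r x))"
    "\<And>x y. x \<in> S \<Longrightarrow> y \<in> S \<Longrightarrow> x \<noteq> y \<Longrightarrow>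
       (r x \<le> dist x y \<and> 9 / 10 * r y \<le> r x) \<or> (r y \<le> dist x y \<and> 9 / 10 * r x \<le> r y)"
    using besicovitch_selection[where A = A and r = r and q = "9 / 10", OF r] by auto
  define G where "G = (\<Union>x\<in>S. ball x (r x))"
  have "open G" by (auto simp: G_def)
  have fin_bound: "measure \<mu> (\<Union>x\<in>F. ball x (r x)) \<le> 9 / c * measure \<mu> D"
    if F: "finite F" "F \<subseteq> S" for F
  proof -
    have "measure \<mu> (\<Union>x\<in>F. ball x (r x)) \<le> (\<Sum>x\<in>F. measure \<mu> (ball x (r x)))"
      using F by (intro finite_measure_subadditive_finite) auto
    also have "\<dots> \<le> (\<Sum>x\<in>F. 1 / c * measure \<mu> (D \<inter> ball x (r x)))"
    proof (rule sum_mono)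
      fix x assume "x \<in> F"
      then show "measure \<mu> (ball x (r x)) \<le> 1 / c * measure \<mu> (D \<inter> ball x (r x))"
        using large[of x] F S(1) \<open>0 < c\<close> by (auto simp: field_simps)
    qed
    also have "\<dots> = 1 / c * (\<Sum>x\<in>F. measure \<mu> (D \<inter> ball x (r x)))"
      by (simp add: sum_distrib_left)
    also have "(\<Sum>x\<in>F. measure \<mu> (D \<inter> ball x (r x))) =
        (\<Sum>x\<in>F. \<integral>z. indicator (D \<inter> ball x (r x)) z \<partial>\<mu>)"
      by (simp add: spc)
    also have "\<dots> = (\<integral>z. (\<Sum>x\<in>F. indicator (D \<inter> ball x (r x)) z) \<partial>\<mu>)"
      by (rule Bochner_Integration.integral_sum[symmetric]) (simp add: less_top[symmetric])
    also have "\<dots> \<le> (\<integral>z. 9 * indicator D z \<partial>\<mu>)"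
    proof (rule integral_mono)
      fix z
      have "(\<Sum>x\<in>F. indicator (D \<inter> ball x (r x)) z :: real) =
          indicator D z * (\<Sum>x\<in>F. if z \<in> ball x (r x) then 1 else 0)"
        unfolding sum_distrib_left by (intro sum.cong) (auto simp: indicator_def)
      also have "(\<Sum>x\<in>F. if z \<in> ball x (r x) then 1 else 0) = real (card {x \<in> F. z \<in> ball x (r x)})"
        using F(1) by (subst sum.inter_filter[symmetric]) auto
      finally have eq: "(\<Sum>x\<in>F. indicator (D \<inter> ball x (r x)) z :: real) =
          indicator D z * real (card {x \<in> F. z \<in> ball x (r x)})" .
      have ov: "finite {x \<in> S. z \<in> ball x (r x)} \<and> card {x \<in> S. z \<in> ball x (r x)} \<le> 9"
        by (rule besicovitch_overlap) (use r S in blast)+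
      moreover have "card {x \<in> F. z \<in> ball x (r x)} \<le> card {x \<in> S. z \<in> ball x (r x)}"
        using ov F(2) by (intro card_mono) auto
      ultimately have "card {x \<in> F. z \<in> ball x (r x)} \<le> 9" by linarith
      then show "(\<Sum>x\<in>F. indicator (D \<inter> ball x (r x)) z) \<le> 9 * (indicator D z :: real)"
        unfolding eq by (simp add: indicator_def)
    qed (auto simp: less_top[symmetric])
    also have "\<dots> = 9 * measure \<mu> D" by (simp add: spc)
    finally show ?thesis using \<open>0 < c\<close> by (simp add: divide_right_mono mult_left_mono)
  qed
  \<comment> \<open>The selection may be uncountable, but a compact subset of G meets the estimate
    through finitely many balls.\<close>
  have "emeasure \<mu> G = (SUP K\<in>{K. K \<subseteq> G \<and> compact K}. emeasure \<mu> K)"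
    by (rule inner_regular[OF sets]) (use \<open>open G\<close> in auto)
  also have "\<dots> \<le> ennreal (9 / c * measure \<mu> D)"
  proof (rule SUP_least)
    fix K assume "K \<in> {K. K \<subseteq> G \<and> compact K}"
    then have K: "compact K" "K \<subseteq> (\<Union>x\<in>S. ball x (r x))" by (auto simp: G_def)
    obtain F where F: "F \<subseteq> S" "finite F" "K \<subseteq> (\<Union>x\<in>F. ball x (r x))"
      using compactE_image[OF K(1), of S "\<lambda>x. ball x (r x)"] K(2) by auto
    have "emeasure \<mu> K \<le> emeasure \<mu> (\<Union>x\<in>F. ball x (r x))"
      using F by (intro emeasure_mono) auto
    also have "\<dots> \<le> ennreal (9 / c * measure \<mu> D)"
      using fin_bound[OF F(2,1)] by (simp add: emeasure_eq_measure ennreal_leI)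
    finally show "emeasure \<mu> K \<le> ennreal (9 / c * measure \<mu> D)" .
  qed
  finally have "measure \<mu> G \<le> 9 / c * measure \<mu> D"
    using \<open>0 < c\<close> by (simp add: emeasure_eq_measure)
  with \<open>open G\<close> S(2) show ?thesis by (intro that[of G]) (auto simp: G_def)
qed

section \<open>Differentiation of finite Borel measures\<close>

lemma AE_not_in_if_open_covers:
  fixes \<mu> :: "plane measure"
  assumes fin: "finite_measure \<mu>" and sets: "sets \<mu> = sets borel"
    and cover: "\<And>e. 0 < e \<Longrightarrow> \<exists>G. open G \<and> B \<subseteq> G \<and> measure \<mu> G \<le> e"
  shows "AE x in \<mu>. x \<notin> B"
proof -
  interpret finite_measure \<mu> by fact
  have "\<forall>n. \<exists>G. open G \<and> B \<subseteq> G \<and> measure \<mu> G \<le> inverse (real (Suc n))"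
    using cover by simp
  then obtain G where G: "\<And>n. open (G n)" "\<And>n. B \<subseteq> G n" "\<And>n. measure \<mu> (G n) \<le> inverse (real (Suc n))"
    by metis
  have [measurable]: "G n \<in> sets \<mu>" for n using G sets by simp
  have "measure \<mu> (\<Inter>n. G n) \<le> e" if "0 < e" for e
  proof -
    obtain n where "inverse (real (Suc n)) < e" using reals_Archimedean[OF \<open>0 < e\<close>] by blast
    moreover have "measure \<mu> (\<Inter>n. G n) \<le> measure \<mu> (G n)"
      by (intro finite_measure_mono) auto
    ultimately show ?thesis using G(3)[of n] by linarith
  qed
  then have "measure \<mu> (\<Inter>n. G n) \<le> 0" by (rule field_le_epsilon) simp
  then have "emeasure \<mu> (\<Inter>n. G n) = 0"
    by (simp add: emeasure_eq_measure measure_le_0_iff)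
  \<comment> \<open>B itself may be non-measurable; the intersection of the covers is a measurable
    null superset.\<close>
  then have "(\<Inter>n. G n) \<in> null_sets \<mu>" by (intro null_setsI) auto
  then show ?thesis by (rule AE_I') (use G in auto)
qed

text \<open>Points with a null ball satisfy the hypothesis of
  \<open>besicovitch_measure_bound\<close> for empty D and c = 1, which puts all of them into an
  open null set.\<close>

lemma AE_measure_ball_pos:
  fixes \<mu> :: "plane measure"
  assumes fin: "finite_measure \<mu>" and sets: "sets \<mu> = sets borel"
  shows "AE x in \<mu>. \<forall>r>0. 0 < measure \<mu> (ball x r)"
proof -
  interpret finite_measure \<mu> by fact
  define B where "B = {x. \<exists>r>0. measure \<mu> (ball x r) = 0}"
  have "\<exists>r. 0 < r \<and> r \<le> 1 \<and> measure \<mu> (ball x r) = 0" if x: "x \<in> B" for x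
  proof -
    obtain s where s: "0 < s" "measure \<mu> (ball x s) = 0" using x by (auto simp: B_def)
    have "measure \<mu> (ball x (min s 1)) \<le> measure \<mu> (ball x s)"
      by (intro finite_measure_mono) (auto simp: sets)
    then show ?thesis using s by (intro exI[of _ "min s 1"]) (auto simp: measure_le_0_iff)
  qed
  then obtain r where r: "\<And>x. x \<in> B \<Longrightarrow> 0 < r x \<and> r x \<le> 1" "\<And>x. x \<in> B \<Longrightarrow> measure \<mu> (ball x (r x)) = 0"
    by metis
  obtain G where "open G" "B \<subseteq> G" "measure \<mu> G \<le> 9 / 1 * measure \<mu> {}"
    by (rule besicovitch_measure_bound[where D = "{}" and A = B and c = 1 and r = r, OF fin sets])
      (simp_all add: r)
  then have "AE x in \<mu>. x \<notin> B"
    by (intro AE_not_in_if_open_covers[OF fin sets]) force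
  then show ?thesis
    by eventually_elim (auto simp: B_def zero_less_measure_iff)
qed

text \<open>Half of the Lebesgue density theorem. Remove from D a compact K of nearly full measure.
  Small balls around a point outside D miss K, so D - K has the same share of them as D. The bad
  points therefore lie in an open set of measure at most 9 / c times that of D - K.\<close>

lemma AE_density_zero:
  fixes \<mu> :: "plane measure"
  assumes fin: "finite_measure \<mu>" and sets: "sets \<mu> = sets borel" and D: "D \<in> sets borel"
  shows "AE x in \<mu>. x \<notin> D \<longrightarrow> (\<forall>c>0. \<exists>\<rho>>0. \<forall>r. 0 < r \<and> r < \<rho> \<longrightarrow>
    measure \<mu> (D \<inter> ball x r) \<le> c * measure \<mu> (ball x r))"
proof -
  interpret finite_measure \<mu> by fact
  define B where "B c = {x. x \<notin> D \<and> (\<forall>\<rho>>0. \<exists>r. 0 < r \<and> r < \<rho> \<and>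
    c * measure \<mu> (ball x r) < measure \<mu> (D \<inter> ball x r))}" for c
  have null: "AE x in \<mu>. x \<notin> B c" if "0 < c" for c
  proof (rule AE_not_in_if_open_covers[OF fin sets])
    fix e :: real assume "0 < e"
    have "emeasure \<mu> D = (SUP K\<in>{K. K \<subseteq> D \<and> compact K}. emeasure \<mu> K)"
      by (rule inner_regular[OF sets _ D]) auto
    moreover have "emeasure \<mu> D \<noteq> top" by simp
    ultimately have "\<exists>K\<in>{K. K \<subseteq> D \<and> compact K}. emeasure \<mu> D < emeasure \<mu> K + ennreal (e * c / 9)"
      using \<open>0 < e\<close> \<open>0 < c\<close> by (intro SUP_approx_ennreal) auto
    then obtain K where K: "K \<subseteq> D" "compact K" "emeasure \<mu> D < emeasure \<mu> K + ennreal (e * c / 9)"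
      by auto
    have Ks: "K \<in> sets \<mu>" using K(2) sets by (simp add: borel_compact)
    have "measure \<mu> D < measure \<mu> K + e * c / 9"
      using K(3) \<open>0 < e\<close> \<open>0 < c\<close>
      by (simp add: emeasure_eq_measure ennreal_less_iff flip: ennreal_plus)
    then have small: "measure \<mu> (D - K) \<le> e * c / 9"
      using finite_measure_Diff[of D K] K D Ks sets by simp
    have "\<exists>r. 0 < r \<and> r \<le> 1 \<and> c * measure \<mu> (ball x r) \<le> measure \<mu> ((D - K) \<inter> ball x r)"
      if x: "x \<in> B c" for x
    proof -
      have "x \<in> - K" using x K by (auto simp: B_def)
      moreover have "open (- K)" using K(2) by (simp add: compact_imp_closed open_Compl)
      ultimately obtain s where s: "0 < s" "ball x s \<subseteq> - K" using open_contains_ball by blast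
      have "0 < min s 1" using s by simp
      then obtain r where r: "0 < r" "r < min s 1" "c * measure \<mu> (ball x r) < measure \<mu> (D \<inter> ball x r)"
        using x unfolding B_def by blast
      have "(D - K) \<inter> ball x r = D \<inter> ball x r" using s r by (auto simp: subset_eq)
      then show ?thesis using r by (intro exI[of _ r]) auto
    qed
    then obtain r where r: "\<And>x. x \<in> B c \<Longrightarrow> 0 < r x \<and> r x \<le> 1"
      "\<And>x. x \<in> B c \<Longrightarrow> c * measure \<mu> (ball x (r x)) \<le> measure \<mu> ((D - K) \<inter> ball x (r x))"
      by metis
    obtain G where "open G" "B c \<subseteq> G" "measure \<mu> G \<le> 9 / c * measure \<mu> (D - K)"
      by (rule besicovitch_measure_bound[where D = "D - K" and A = "B c" and c = c and r = r, OF fin sets])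
        (use D Ks sets r \<open>0 < c\<close> in simp_all)
    moreover have "9 / c * measure \<mu> (D - K) \<le> e"
      using small \<open>0 < c\<close> by (simp add: field_simps)
    ultimately show "\<exists>G. open G \<and> B c \<subseteq> G \<and> measure \<mu> G \<le> e" by force
  qed
  have "AE x in \<mu>. \<forall>n. x \<notin> B (inverse (real (Suc n)))"
    unfolding AE_all_countable by (auto intro: null)
  then show ?thesis
  proof eventually_elim
    case (elim x)
    show ?case
    proof (intro impI allI)
      fix c :: real assume "x \<notin> D" "0 < c"
      obtain n where n: "inverse (real (Suc n)) < c" using reals_Archimedean[OF \<open>0 < c\<close>] by blast
      obtain \<rho> where "0 < \<rho>" and \<rho>': "\<not> (\<exists>r. 0 < r \<and> r < \<rho> \<and>
          inverse (real (Suc n)) * measure \<mu> (ball x r) < measure \<mu> (D \<inter> ball x r))"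
        using elim[rule_format, of n] \<open>x \<notin> D\<close> unfolding B_def by blast
      have \<rho>: "measure \<mu> (D \<inter> ball x r) \<le> inverse (real (Suc n)) * measure \<mu> (ball x r)"
        if "0 < r" "r < \<rho>" for r
        using \<rho>' that not_le by blast
      have "inverse (real (Suc n)) * measure \<mu> (ball x r) \<le> c * measure \<mu> (ball x r)" for r
        using n by (intro mult_right_mono) auto
      then show "\<exists>\<rho>>0. \<forall>r. 0 < r \<and> r < \<rho> \<longrightarrow> measure \<mu> (D \<inter> ball x r) \<le> c * measure \<mu> (ball x r)"
        using \<open>0 < \<rho>\<close> \<rho> by (meson order_trans)
    qed
  qed
qed

text \<open>Density zero is applied to the countably many sets \<open>D q n\<close>. Near almost
  every x, with q close to f x, the function stays within \<open>2 * \<epsilon>\<close> of f x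
  except on a set of small relative measure, where the difference is at most 2 M.\<close>

lemma AE_lebesgue_point:
  fixes \<mu> :: "plane measure" and f :: "plane \<Rightarrow> plane"
  assumes fin: "finite_measure \<mu>" and sets: "sets \<mu> = sets borel"
    and f [measurable]: "f \<in> borel_measurable borel" and bound: "AE x in \<mu>. norm (f x) \<le> M"
  shows "AE x in \<mu>. ((\<lambda>r. (LINT y:ball x r|\<mu>. f y) /\<^sub>R measure \<mu> (ball x r)) \<longlongrightarrow> f x) (at_right 0)"
proof -
  interpret finite_measure \<mu> by fact
  note sets [measurable_cong]
  have spc: "space \<mu> = UNIV" using sets_eq_imp_space_eq[OF sets] by simp
  obtain Q :: "plane set" where Q: "countable Q" "\<And>X. open X \<Longrightarrow> X \<noteq> {} \<Longrightarrow> \<exists>q\<in>Q. q \<in> X"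
    using countable_dense_setE by blast
  define D where "D q n = {y. \<not> dist q (f y) < inverse (real (Suc n))}" for q n
  have D [measurable]: "D q n \<in> sets borel" for q n unfolding D_def by measurable
  have "AE x in \<mu>. \<forall>q\<in>Q. \<forall>n. x \<notin> D q n \<longrightarrow> (\<forall>c>0. \<exists>\<rho>>0. \<forall>r. 0 < r \<and> r < \<rho> \<longrightarrow>
    measure \<mu> (D q n \<inter> ball x r) \<le> c * measure \<mu> (ball x r))"
    unfolding AE_ball_countable[OF Q(1)] AE_all_countable
    by (intro ballI allI AE_density_zero[OF fin sets D])
  moreover note AE_measure_ball_pos[OF fin sets] bound
  ultimately show ?thesis
  proof eventually_elim
    case (elim x)
    have "0 \<le> M" using elim(3) norm_ge_zero[of "f x"] by linarith
    have int_f: "integrable \<mu> f"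
      by (rule integrable_const_bound[OF bound]) simp
    show ?case
    proof (rule tendstoI)
      fix e :: real assume "0 < e"
      \<comment> \<open>Makes 2 M c at most e / 2, while n makes the other error term less than e /
        2; M + 1 avoids dividing by 0.\<close>
      define c where "c = e / (4 * (M + 1))"
      have "0 < c" using \<open>0 < e\<close> \<open>0 \<le> M\<close> by (simp add: c_def)
      obtain n where n: "inverse (real (Suc n)) < e / 4" using reals_Archimedean[of "e / 4"] \<open>0 < e\<close> by auto
      define \<epsilon> where "\<epsilon> = inverse (real (Suc n))"
      obtain q where q: "q \<in> Q" "q \<in> ball (f x) \<epsilon>"
        using Q(2)[of "ball (f x) \<epsilon>"] by (auto simp: \<epsilon>_def)
      then have "x \<notin> D q n" by (simp add: D_def \<epsilon>_def dist_commute)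
      then obtain \<rho> where \<rho>: "0 < \<rho>" "\<And>r. 0 < r \<Longrightarrow> r < \<rho> \<Longrightarrow>
          measure \<mu> (D q n \<inter> ball x r) \<le> c * measure \<mu> (ball x r)"
        using elim(1)[rule_format, OF q(1) \<open>x \<notin> D q n\<close> \<open>0 < c\<close>] by auto
      have "dist ((LINT y:ball x r|\<mu>. f y) /\<^sub>R measure \<mu> (ball x r)) (f x) < e"
        if r: "0 < r" "r < \<rho>" for r
      proof -
        define m where "m = measure \<mu> (ball x r)"
        have "0 < m" using elim(2) r by (simp add: m_def)
        have [simp]: "integrable \<mu> (\<lambda>y. indicator (ball x r) y *\<^sub>R f y)"
          using int_f by (intro integrable_mult_indicator) auto
        have "(LINT y:ball x r|\<mu>. f y) /\<^sub>R m - f x = (\<integral>y. indicator (ball x r) y *\<^sub>R (f y - f x) \<partial>\<mu>) /\<^sub>R m"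
          using \<open>0 < m\<close> int_f
          by (simp add: set_lebesgue_integral_def scaleR_diff_right Bochner_Integration.integral_diff
              integrable_mult_indicator less_top[symmetric] m_def spc)
        then have "dist ((LINT y:ball x r|\<mu>. f y) /\<^sub>R m) (f x) =
            norm (\<integral>y. indicator (ball x r) y *\<^sub>R (f y - f x) \<partial>\<mu>) / m"
          using \<open>0 < m\<close> by (simp add: dist_norm divide_inverse_commute)
        also have "norm (\<integral>y. indicator (ball x r) y *\<^sub>R (f y - f x) \<partial>\<mu>) \<le>
            (\<integral>y. 2 * \<epsilon> * indicator (ball x r) y + 2 * M * indicator (D q n \<inter> ball x r) y \<partial>\<mu>)"
        proof (rule order_trans[OF integral_norm_bound integral_mono_AE])
          have "AE y in \<mu>. norm (f y) \<le> M" by fact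
          then show "AE y in \<mu>. norm (indicator (ball x r) y *\<^sub>R (f y - f x)) \<le>
            2 * \<epsilon> * indicator (ball x r) y + 2 * M * indicator (D q n \<inter> ball x r) y"
          proof eventually_elim
            case (elim y)
            have "norm (f y - f x) \<le> 2 * M"
              using norm_triangle_ineq4[of "f y" "f x"] elim \<open>norm (f x) \<le> M\<close> by linarith
            moreover have "norm (f y - f x) \<le> 2 * \<epsilon>" if "y \<notin> D q n"
              using that q(2) dist_triangle[of "f y" "f x" q]
              by (auto simp: D_def \<epsilon>_def dist_norm norm_minus_commute)
            moreover have "0 \<le> \<epsilon>" by (simp add: \<epsilon>_def)
            ultimately show ?case using \<open>0 \<le> M\<close> by (auto simp: indicator_def)
          qed
        qed (use int_f in \<open>simp_all add: scaleR_diff_right integrable_mult_indicator less_top[symmetric]\<close>)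
        also have "\<dots> = 2 * \<epsilon> * m + 2 * M * measure \<mu> (D q n \<inter> ball x r)"
          by (simp add: less_top[symmetric] m_def spc)
        also have "\<dots> \<le> 2 * \<epsilon> * m + 2 * M * (c * m)"
          using \<rho>(2)[OF r] \<open>0 \<le> M\<close> by (intro add_left_mono mult_left_mono) (auto simp: m_def)
        also have "\<dots> < e * m"
        proof -
          have "2 * M * c \<le> e / 2" using \<open>0 \<le> M\<close> \<open>0 < e\<close> by (simp add: c_def field_simps)
          then have "2 * \<epsilon> + 2 * M * c < e" using n by (simp add: \<epsilon>_def)
          then have "(2 * \<epsilon> + 2 * M * c) * m < e * m" using \<open>0 < m\<close> by (intro mult_strict_right_mono)
          then show ?thesis by (simp add: algebra_simps)
        qed
        finally show ?thesis using \<open>0 < m\<close> by (simp add: m_def divide_right_mono pos_divide_less_eq)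
      qed
      then show "\<forall>\<^sub>F r in at_right 0. dist ((LINT y:ball x r|\<mu>. f y) /\<^sub>R measure \<mu> (ball x r)) (f x) < e"
        unfolding eventually_at_right_field using \<rho>(1) by blast
    qed
  qed
qed

section \<open>Test fields for the Gauss--Green formula\<close>

definition sq_pos :: "real \<Rightarrow> real" where "sq_pos t = (max 0 t)\<^sup>2"

text \<open>On [0, 1] this is (1 - t^2)^2, a step from 1 to 0. Squaring positive parts gives C^1
  regularity, which is all that \<open>C1c_field\<close> requires, with an explicit
  derivative.\<close>

definition cutoff :: "real \<Rightarrow> real" where "cutoff t = sq_pos (1 - sq_pos t)"

definition cutoff_deriv :: "real \<Rightarrow> real" where
  "cutoff_deriv t = - 4 * max 0 (1 - sq_pos t) * max 0 t"

lemma sq_pos_has_field_derivative: "(sq_pos has_field_derivative 2 * max 0 t) (at t)"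
proof -
  consider "t < 0" | "t = 0" | "0 < t" by linarith
  then show ?thesis
  proof cases
    case 1
    have "((\<lambda>_. 0) has_field_derivative 2 * max 0 t) (at t)" using 1 by simp
    then show ?thesis
      by (rule has_field_derivative_transform_within[where d = "- t"])
        (use 1 in \<open>auto simp: sq_pos_def dist_real_def max_def\<close>)
  next
    case 2
    have "((\<lambda>h. max 0 h) \<longlongrightarrow> max 0 (0::real)) (at 0)" by (intro tendsto_intros)
    moreover have "\<forall>\<^sub>F h in at 0. max 0 h = sq_pos h / h"
      by (auto simp: eventually_at_filter sq_pos_def max_def power2_eq_square)
    ultimately have "((\<lambda>h. sq_pos h / h) \<longlongrightarrow> 0) (at 0)"
      by (auto intro: Lim_transform_eventually)
    then show ?thesis using 2 by (simp add: DERIV_def sq_pos_def)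
  next
    case 3
    have "((\<lambda>x. x\<^sup>2) has_field_derivative 2 * max 0 t) (at t)" using 3 by (auto intro!: derivative_eq_intros)
    then show ?thesis
      by (rule has_field_derivative_transform_within[where d = t])
        (use 3 in \<open>auto simp: sq_pos_def dist_real_def max_def\<close>)
  qed
qed

lemma cutoff_has_field_derivative: "(cutoff has_field_derivative cutoff_deriv t) (at t)"
proof -
  have "((\<lambda>t. 1 - sq_pos t) has_field_derivative - (2 * max 0 t)) (at t)"
    by (auto intro!: derivative_eq_intros sq_pos_has_field_derivative)
  from DERIV_chain2[OF sq_pos_has_field_derivative this] show ?thesis
    unfolding cutoff_def[abs_def] by (rule DERIV_cong) (simp add: cutoff_deriv_def)
qed

lemma continuous_on_cutoff_deriv [continuous_intros]:
  "continuous_on A f \<Longrightarrow> continuous_on A (\<lambda>x. cutoff_deriv (f x))"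
  unfolding cutoff_deriv_def sq_pos_def by (intro continuous_intros)

lemma cutoff_bounds: "0 \<le> cutoff t" "cutoff t \<le> 1"
  by (auto simp: cutoff_def sq_pos_def power_le_one_iff max_def)

lemma cutoff_eq_1: "t \<le> 0 \<Longrightarrow> cutoff t = 1"
  by (simp add: cutoff_def sq_pos_def)

lemma sq_pos_ge_1: "1 \<le> t \<Longrightarrow> 1 \<le> sq_pos t"
  by (simp add: sq_pos_def max_def one_le_power)

lemma cutoff_eq_0: "1 \<le> t \<Longrightarrow> cutoff t = 0"
  using sq_pos_ge_1[of t] by (simp add: cutoff_def sq_pos_def[of "1 - _"])

lemma cutoff_deriv_eq_0: "t \<le> 0 \<or> 1 \<le> t \<Longrightarrow> cutoff_deriv t = 0"
  using sq_pos_ge_1[of t] by (auto simp: cutoff_deriv_def)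

text \<open>On [0, 1] the derivative is - 4 (1 - t^2) t with both factors in [0, 1]. This crude 4
  leads to the constant 8 pi below.\<close>

lemma abs_cutoff_deriv_le: "\<bar>cutoff_deriv t\<bar> \<le> 4"
proof (cases "t \<le> 0 \<or> 1 \<le> t")
  case True then show ?thesis by (simp add: cutoff_deriv_eq_0)
next
  case False
  then have "0 \<le> 1 - t\<^sup>2" "1 - t\<^sup>2 \<le> 1" "0 \<le> t" "t \<le> 1" by (auto simp: power_le_one_iff)
  then have "(1 - t\<^sup>2) * t \<le> 1" "0 \<le> (1 - t\<^sup>2) * t" by (auto intro: mult_le_one)
  then show ?thesis using False by (simp add: cutoff_deriv_def sq_pos_def max_def abs_mult)
qed

text \<open>The squared distance avoids differentiating the norm at the centre. It also puts r^2 -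
  s^2 into the denominator of the derivative, where it cancels against the area of the
  annulus.\<close>

definition bump :: "plane \<Rightarrow> real \<Rightarrow> real \<Rightarrow> plane \<Rightarrow> real" where
  "bump x s r y = cutoff (((y - x) \<bullet> (y - x) - s\<^sup>2) / (r\<^sup>2 - s\<^sup>2))"

definition bump_deriv :: "plane \<Rightarrow> real \<Rightarrow> real \<Rightarrow> plane \<Rightarrow> plane \<Rightarrow> real" where
  "bump_deriv x s r y h =
     cutoff_deriv (((y - x) \<bullet> (y - x) - s\<^sup>2) / (r\<^sup>2 - s\<^sup>2)) * (2 * ((y - x) \<bullet> h) / (r\<^sup>2 - s\<^sup>2))"

lemma bump_has_derivative: "(bump x s r has_derivative bump_deriv x s r y) (at y)"
proof -
  have "((\<lambda>y. ((y - x) \<bullet> (y - x) - s\<^sup>2) / (r\<^sup>2 - s\<^sup>2)) has_derivative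
      (\<lambda>h. 2 * ((y - x) \<bullet> h) / (r\<^sup>2 - s\<^sup>2))) (at y)"
    unfolding divide_inverse by (auto intro!: derivative_eq_intros simp: inner_commute)
  from has_derivative_compose[OF this cutoff_has_field_derivative[unfolded has_field_derivative_def]]
  show ?thesis
    by (simp add: bump_def[abs_def] bump_deriv_def[abs_def])
qed

lemma continuous_on_bump_deriv: "continuous_on A (\<lambda>y. bump_deriv x s r y h)"
  unfolding bump_deriv_def divide_inverse by (intro continuous_intros)

lemma continuous_on_bump [continuous_intros]: "continuous_on A (bump x s r)"
  by (meson bump_has_derivative continuous_at_imp_continuous_on has_derivative_continuous)

lemma bump_bounds: "0 \<le> bump x s r y" "bump x s r y \<le> 1"
  by (simp_all add: bump_def cutoff_bounds)

lemma bump_inside: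
  assumes "0 \<le> s" "s < r" "dist x y \<le> s"
  shows "bump x s r y = 1" "bump_deriv x s r y h = 0"
proof -
  have "(y - x) \<bullet> (y - x) \<le> s\<^sup>2"
    using assms by (simp add: dist_norm norm_minus_commute flip: power2_norm_eq_inner)
  moreover have "s\<^sup>2 < r\<^sup>2" using assms by (simp add: power_strict_mono)
  ultimately have "((y - x) \<bullet> (y - x) - s\<^sup>2) / (r\<^sup>2 - s\<^sup>2) \<le> 0" by (simp add: divide_nonpos_pos)
  then show "bump x s r y = 1" "bump_deriv x s r y h = 0"
    by (simp_all add: bump_def bump_deriv_def cutoff_eq_1 cutoff_deriv_eq_0)
qed

lemma bump_outside:
  assumes "0 \<le> s" "s < r" "r \<le> dist x y"
  shows "bump x s r y = 0" "bump_deriv x s r y h = 0"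
proof -
  have "r\<^sup>2 \<le> (y - x) \<bullet> (y - x)"
    using assms by (simp add: dist_norm norm_minus_commute flip: power2_norm_eq_inner)
  moreover have "s\<^sup>2 < r\<^sup>2" using assms by (simp add: power_strict_mono)
  ultimately have "1 \<le> ((y - x) \<bullet> (y - x) - s\<^sup>2) / (r\<^sup>2 - s\<^sup>2)" by simp
  then show "bump x s r y = 0" "bump_deriv x s r y h = 0"
    by (simp_all add: bump_def bump_deriv_def cutoff_eq_0 cutoff_deriv_eq_0)
qed

lemma abs_bump_deriv_le:
  assumes "0 \<le> s" "s < r" "norm v \<le> 1"
  shows "\<bar>bump_deriv x s r y v\<bar> \<le> 8 * r / (r\<^sup>2 - s\<^sup>2) * indicator (ball x r - ball x s) y"
proof (cases "y \<in> ball x r - ball x s")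
  case True
  have pos: "0 < r\<^sup>2 - s\<^sup>2" using assms by (simp add: power_strict_mono)
  have "\<bar>(y - x) \<bullet> v\<bar> \<le> norm (y - x) * norm v" by (rule Cauchy_Schwarz_ineq2)
  also have "\<dots> \<le> r * 1"
    using True assms by (intro mult_mono) (auto simp: dist_norm norm_minus_commute)
  finally have "\<bar>(y - x) \<bullet> v\<bar> \<le> r" by simp
  then have "\<bar>2 * ((y - x) \<bullet> v) / (r\<^sup>2 - s\<^sup>2)\<bar> \<le> 2 * r / (r\<^sup>2 - s\<^sup>2)"
    using pos by (simp add: abs_mult divide_right_mono)
  then have "\<bar>bump_deriv x s r y v\<bar> \<le> 4 * (2 * r / (r\<^sup>2 - s\<^sup>2))"
    unfolding bump_deriv_def abs_mult by (intro mult_mono abs_cutoff_deriv_le) auto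
  then show ?thesis using True by simp
next
  case False
  then have "r \<le> dist x y \<or> dist x y \<le> s" by (auto simp: not_less)
  then show ?thesis using False bump_inside(2)[OF assms(1,2)] bump_outside(2)[OF assms(1,2)] by auto
qed

text \<open>All test fields below have a constant direction v, which reduces the divergence to the
  derivative of u along v.\<close>

lemma C1c_field_scaleR:
  fixes u :: "plane \<Rightarrow> real"
  assumes u: "\<And>y. (u has_derivative u' y) (at y)"
    and cont: "\<And>h. continuous_on UNIV (\<lambda>y. u' y h)" and supp: "bounded {y. u y \<noteq> 0}"
  shows "C1c_field (\<lambda>y. u y *\<^sub>R v)" "divergence (\<lambda>y. u y *\<^sub>R v) y = u' y v"
proof -
  have der: "((\<lambda>y. u y *\<^sub>R v) has_derivative (\<lambda>h. u' y h *\<^sub>R v)) (at y)" for y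
    by (intro has_derivative_scaleR_left u)
  then have fd: "frechet_derivative (\<lambda>y. u y *\<^sub>R v) (at y) = (\<lambda>h. u' y h *\<^sub>R v)" for y
    by (rule frechet_derivative_at[symmetric])
  have "bounded {y. u y *\<^sub>R v \<noteq> 0}" by (rule bounded_subset[OF supp]) auto
  then show "C1c_field (\<lambda>y. u y *\<^sub>R v)"
    unfolding C1c_field_def fd using der cont
    by (auto simp: differentiable_def compact_closure intro!: continuous_intros)
  have lin: "linear (u' y)" using u[of y] by (rule has_derivative_linear)
  have "divergence (\<lambda>y. u y *\<^sub>R v) y = (\<Sum>b\<in>Basis. (v \<bullet> b) * u' y b)"
    by (simp add: divergence_def fd mult.commute)
  also have "\<dots> = u' y (\<Sum>b\<in>Basis. (v \<bullet> b) *\<^sub>R b)"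
    by (simp add: linear_sum[OF lin] linear_cmul[OF lin])
  also have "\<dots> = u' y v" by (simp add: euclidean_representation)
  finally show "divergence (\<lambda>y. u y *\<^sub>R v) y = u' y v" .
qed

text \<open>The cutoff has directional derivative at most 8 r / (r^2 - s^2), supported in an annulus
  of area pi (r^2 - s^2). The product does not depend on s, so s may tend to r and the cutoff to the
  indicator of the ball.\<close>

lemma gauss_green_ball_bound:
  assumes gg: "gauss_green E \<mu> \<sigma>" and "0 < r"
  shows "norm (LINT y:ball x r|\<mu>. \<sigma> y) \<le> 8 * pi * r"
proof -
  have sets [measurable_cong]: "sets \<mu> = sets borel" and [measurable]: "\<sigma> \<in> borel_measurable borel"
    and nrm: "AE x in \<mu>. norm (\<sigma> x) = 1" and "finite_measure \<mu>"
    and div: "\<And>\<phi>. C1c_field \<phi> \<Longrightarrow> (LINT x:E|lborel. divergence \<phi> x) = (LINT x|\<mu>. \<phi> x \<bullet> \<sigma> x)"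
    using gg by (auto simp: gauss_green_def)
  interpret finite_measure \<mu> by fact
  have spc: "space \<mu> = UNIV" using sets_eq_imp_space_eq[OF sets] by simp
  \<comment> \<open>The inequality on norm v allows v = \<open>sgn w\<close> at the end even for w =
    0, where \<open>sgn\<close> is 0.\<close>
  have inner_le: "(LINT y:ball x r|\<mu>. \<sigma> y) \<bullet> v \<le> 8 * pi * r" if v: "norm v \<le> 1" for v
  proof -
    define s where "s n = r * (1 - inverse (real (Suc n)))" for n
    have s: "0 \<le> s n" "s n < r" for n
      using \<open>0 < r\<close> by (auto simp: s_def field_simps)
    have s_lim: "s \<longlonglongrightarrow> r"
    proof -
      have "s \<longlonglongrightarrow> r * (1 - 0)"
        unfolding s_def[abs_def] by (intro tendsto_intros LIMSEQ_inverse_real_of_nat)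
      then show ?thesis by simp
    qed
    have le: "(\<integral>y. bump x (s n) r y * (v \<bullet> \<sigma> y) \<partial>\<mu>) \<le> 8 * pi * r" for n
    proof -
      have pos: "0 < r\<^sup>2 - (s n)\<^sup>2" using s[of n] by (simp add: power_strict_mono)
      have "{y. bump x (s n) r y \<noteq> 0} \<subseteq> ball x r"
        using bump_outside(1)[OF s[of n]] by (force simp: not_less)
      then have supp: "bounded {y. bump x (s n) r y \<noteq> 0}" by (rule bounded_subset[rotated]) simp
      note C1 = C1c_field_scaleR[OF bump_has_derivative continuous_on_bump_deriv supp, of v]
      have "(\<integral>y. bump x (s n) r y * (v \<bullet> \<sigma> y) \<partial>\<mu>) = (LINT y:E|lborel. bump_deriv x (s n) r y v)"
        using div[OF C1(1)] by (simp add: C1(2))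
      also have "\<dots> \<le> (\<integral>y. 8 * r / (r\<^sup>2 - (s n)\<^sup>2) * indicator (ball x r - ball x (s n)) y \<partial>lborel)"
        unfolding set_lebesgue_integral_def
      proof (rule integral_mono')
        show "indicator E y *\<^sub>R bump_deriv x (s n) r y v \<le>
            8 * r / (r\<^sup>2 - (s n)\<^sup>2) * indicator (ball x r - ball x (s n)) y" for y
          using abs_bump_deriv_le[OF s[of n] v, of x y] by (auto simp: indicator_def split: if_splits)
        show "0 \<le> 8 * r / (r\<^sup>2 - (s n)\<^sup>2) * indicator (ball x r - ball x (s n)) y" for y
          using pos \<open>0 < r\<close> by simp
        show "integrable lborel (\<lambda>y. 8 * r / (r\<^sup>2 - (s n)\<^sup>2) * indicator (ball x r - ball x (s n)) y)"
          by (intro integrable_mult_right integrable_real_indicator)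
            (auto intro!: emeasure_bounded_finite[unfolded infinity_ennreal_def] bounded_subset[OF bounded_ball])
      qed
      also have "\<dots> = 8 * r / (r\<^sup>2 - (s n)\<^sup>2) * measure lborel (ball x r - ball x (s n))" by simp
      also have "measure lborel (ball x r - ball x (s n)) = measure lborel (ball x r) - measure lborel (ball x (s n))"
        using s[of n] emeasure_lborel_ball_finite[of x r] by (intro measure_Diff) auto
      also have "\<dots> = pi * (r\<^sup>2 - (s n)\<^sup>2)"
        using \<open>0 < r\<close> s[of n] by (simp add: content_ball unit_ball_vol_2 right_diff_distrib)
      also have "8 * r / (r\<^sup>2 - (s n)\<^sup>2) * \<dots> = 8 * pi * r" using pos by simp
      finally show ?thesis .
    qed
    have [measurable]: "bump x (s n) r \<in> borel_measurable borel" for n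
      by (intro borel_measurable_continuous_onI continuous_on_bump)
    have "(\<lambda>n. \<integral>y. bump x (s n) r y * (v \<bullet> \<sigma> y) \<partial>\<mu>) \<longlonglongrightarrow> (\<integral>y. indicator (ball x r) y * (v \<bullet> \<sigma> y) \<partial>\<mu>)"
    proof (rule integral_dominated_convergence)
      show "integrable \<mu> (\<lambda>_. 1 :: real)" by simp
      show "AE y in \<mu>. (\<lambda>n. bump x (s n) r y * (v \<bullet> \<sigma> y)) \<longlonglongrightarrow> indicator (ball x r) y * (v \<bullet> \<sigma> y)"
      proof (intro AE_I2 tendsto_mult_right)
        fix y
        show "(\<lambda>n. bump x (s n) r y) \<longlonglongrightarrow> indicator (ball x r) y"
        proof (cases "y \<in> ball x r")
          case True
          then have "\<forall>\<^sub>F n in sequentially. dist x y < s n"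
            using order_tendstoD(1)[OF s_lim] by auto
          then have "\<forall>\<^sub>F n in sequentially. bump x (s n) r y = 1"
            by eventually_elim (use s in \<open>auto intro: bump_inside\<close>)
          then show ?thesis using True by (auto intro: tendsto_eventually)
        next
          case False
          then have "bump x (s n) r y = 0" for n using bump_outside(1)[OF s[of n]] by (auto simp: not_less)
          then show ?thesis using False by simp
        qed
      qed
      show "AE y in \<mu>. norm (bump x (s n) r y * (v \<bullet> \<sigma> y)) \<le> 1" for n
        using nrm
      proof eventually_elim
        case (elim y)
        have "\<bar>v \<bullet> \<sigma> y\<bar> \<le> 1"
          using Cauchy_Schwarz_ineq2[of v "\<sigma> y"] elim v by simp
        then show ?case
          using bump_bounds[of x "s n" r y] by (auto simp: abs_mult intro: mult_le_one)
      qed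
      show "(\<lambda>y. indicator (ball x r) y * (v \<bullet> \<sigma> y)) \<in> borel_measurable \<mu>"
        by (intro borel_measurable_times borel_measurable_indicator) (auto simp: sets)
    qed auto
    then have *: "(\<integral>y. indicator (ball x r) y * (v \<bullet> \<sigma> y) \<partial>\<mu>) \<le> 8 * pi * r"
      by (rule LIMSEQ_le_const2) (use le in auto)
    have int: "integrable \<mu> (\<lambda>y. indicator (ball x r) y *\<^sub>R \<sigma> y)"
      using nrm by (intro integrable_mult_indicator integrable_const_bound[where B = 1]) auto
    have "(LINT y:ball x r|\<mu>. \<sigma> y) \<bullet> v = (\<integral>y. (indicator (ball x r) y *\<^sub>R \<sigma> y) \<bullet> v \<partial>\<mu>)"
      unfolding set_lebesgue_integral_def using int by (intro integral_inner_left[symmetric]) auto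
    also have "\<dots> = (\<integral>y. indicator (ball x r) y * (v \<bullet> \<sigma> y) \<partial>\<mu>)" by (simp add: inner_commute)
    finally show ?thesis using * by simp
  qed
  define w where "w = (LINT y:ball x r|\<mu>. \<sigma> y)"
  have "w \<bullet> sgn w = norm w" by (cases "w = 0") (auto simp: sgn_div_norm dot_square_norm power2_eq_square)
  then show ?thesis using inner_le[of "sgn w"] by (simp add: w_def norm_sgn)
qed

lemma gauss_green_measure_le:
  assumes gg: "gauss_green E \<mu> \<sigma>" and E: "E \<in> sets borel" "E \<subseteq> ball 0 R" and "0 < R" and e: "norm e = 1"
  shows "measure lborel E \<le> 2 * R * (\<integral>x. \<bar>e \<bullet> \<sigma> x\<bar> \<partial>\<mu>)"
proof -
  have sets [measurable_cong]: "sets \<mu> = sets borel" and [measurable]: "\<sigma> \<in> borel_measurable borel"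
    and nrm: "AE x in \<mu>. norm (\<sigma> x) = 1" and "finite_measure \<mu>"
    and div: "\<And>\<phi>. C1c_field \<phi> \<Longrightarrow> (LINT x:E|lborel. divergence \<phi> x) = (LINT x|\<mu>. \<phi> x \<bullet> \<sigma> x)"
    using gg by (auto simp: gauss_green_def)
  interpret finite_measure \<mu> by fact
  let ?b = "bump 0 R (2 * R)" and ?b' = "bump_deriv 0 R (2 * R)"
  define u where "u y = ?b y * (y \<bullet> e)" for y
  define u' where "u' y h = ?b y * (h \<bullet> e) + ?b' y h * (y \<bullet> e)" for y h
  have R: "0 \<le> R" "R < 2 * R" using \<open>0 < R\<close> by auto
  have der: "(u has_derivative u' y) (at y)" for y
    unfolding u_def[abs_def] u'_def[abs_def]
    by (rule has_derivative_mult[OF bump_has_derivative]) (auto intro!: derivative_eq_intros)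
  have cont: "continuous_on UNIV (\<lambda>y. u' y h)" for h
    unfolding u'_def by (intro continuous_intros continuous_on_bump continuous_on_bump_deriv)
  have zero: "?b y = 0" if "2 * R \<le> norm y" for y
    using bump_outside(1)[OF R, of 0 y] that by simp
  have "{y. u y \<noteq> 0} \<subseteq> ball 0 (2 * R)"
    using zero by (force simp: u_def not_less)
  then have supp: "bounded {y. u y \<noteq> 0}" by (rule bounded_subset[rotated]) simp
  note C1 = C1c_field_scaleR[OF der cont supp, of e]
  \<comment> \<open>The cutoff is 1 on the ball containing E and vanishes beyond radius 2 R: the
    origin of the factor 2 R.\<close>
  have u_le: "\<bar>u y\<bar> \<le> 2 * R" for y
  proof (cases "2 * R \<le> norm y")
    case True then show ?thesis using zero \<open>0 < R\<close> by (simp add: u_def)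
  next
    case False
    have "\<bar>u y\<bar> \<le> 1 * \<bar>y \<bullet> e\<bar>"
      unfolding u_def abs_mult using bump_bounds[of 0 R "2 * R" y] by (intro mult_right_mono) auto
    also have "\<dots> \<le> 2 * R" using Cauchy_Schwarz_ineq2[of y e] e False by simp
    finally show ?thesis .
  qed
  have one: "u' y e = 1" if "y \<in> E" for y
  proof -
    have "dist 0 y \<le> R" using that E(2) by (auto simp: subset_eq intro: less_imp_le)
    then show ?thesis using bump_inside[OF R] e by (simp add: u'_def dot_square_norm)
  qed
  have "emeasure lborel E \<le> emeasure lborel (ball (0::plane) R)" by (intro emeasure_mono E) auto
  then have fin: "emeasure lborel E < \<infinity>"
    using emeasure_lborel_ball_finite[of "0::plane" R] by (rule le_less_trans)
  have "measure lborel E = (LINT y:E|lborel. u' y e)"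
    unfolding set_lebesgue_integral_def
    using E(1) one by (subst Bochner_Integration.integral_cong[of lborel lborel _ "indicator E"]) (auto simp: indicator_def)
  also have "\<dots> = (\<integral>y. u y * (e \<bullet> \<sigma> y) \<partial>\<mu>)" using div[OF C1(1)] by (simp add: C1(2))
  also have "\<dots> \<le> (\<integral>y. 2 * R * \<bar>e \<bullet> \<sigma> y\<bar> \<partial>\<mu>)"
  proof (rule integral_mono')
    have "AE y in \<mu>. norm \<bar>e \<bullet> \<sigma> y\<bar> \<le> 1"
      using nrm
    proof eventually_elim
      case (elim y)
      then show ?case using Cauchy_Schwarz_ineq2[of e "\<sigma> y"] e by simp
    qed
    then show "integrable \<mu> (\<lambda>y. 2 * R * \<bar>e \<bullet> \<sigma> y\<bar>)"
      by (intro integrable_mult_right integrable_const_bound) auto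
    show "u y * (e \<bullet> \<sigma> y) \<le> 2 * R * \<bar>e \<bullet> \<sigma> y\<bar>" for y
    proof -
      have "u y * (e \<bullet> \<sigma> y) \<le> \<bar>u y\<bar> * \<bar>e \<bullet> \<sigma> y\<bar>" by (metis abs_ge_self abs_mult)
      also have "\<dots> \<le> 2 * R * \<bar>e \<bullet> \<sigma> y\<bar>" by (intro mult_right_mono u_le) auto
      finally show ?thesis .
    qed
  qed (use \<open>0 < R\<close> in auto)
  finally show ?thesis by simp
qed

section \<open>Lower bound for the Cheeger constant\<close>

text \<open>Lower semicontinuity in the centre: smaller concentric balls exhaust
  \<open>ball x r\<close> and lie in \<open>ball y r\<close> for y near x. It makes the sets
  \<open>F k\<close> in the comparison with Hausdorff measure closed.\<close>

lemma closed_measure_ball_le: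
  fixes \<mu> :: "'a::metric_space measure"
  assumes fin: "finite_measure \<mu>" and sets: "sets \<mu> = sets borel"
  shows "closed {x. measure \<mu> (ball x r) \<le> c}"
proof -
  interpret finite_measure \<mu> by fact
  have "open {x. c < measure \<mu> (ball x r)}"
    unfolding open_dist
  proof safe
    fix x assume x: "c < measure \<mu> (ball x r)"
    define s where "s n = r - inverse (real (Suc n))" for n
    have "incseq s" unfolding s_def by (intro incseq_SucI) (simp add: field_simps)
    then have inc: "incseq (\<lambda>n. ball x (s n))" by (auto simp: incseq_def intro!: subset_ball)
    have U: "(\<Union>n. ball x (s n)) = ball x r"
    proof safe
      fix y assume "y \<in> ball x r"
      then obtain n where "inverse (real (Suc n)) < r - dist x y"
        using reals_Archimedean[of "r - dist x y"] by auto
      then show "y \<in> (\<Union>n. ball x (s n))" by (auto simp: s_def intro!: exI[of _ n])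
    next
      fix y n assume "y \<in> ball x (s n)"
      moreover have "s n < r" by (simp add: s_def)
      ultimately show "y \<in> ball x r" by simp
    qed
    have "(\<lambda>n. measure \<mu> (ball x (s n))) \<longlonglongrightarrow> measure \<mu> (\<Union>n. ball x (s n))"
      by (rule finite_Lim_measure_incseq) (auto simp: sets inc)
    then have "\<forall>\<^sub>F n in sequentially. c < measure \<mu> (ball x (s n))"
      unfolding U using x by (rule order_tendstoD)
    then obtain n where n: "c < measure \<mu> (ball x (s n))" by (auto simp: eventually_sequentially)
    have "c < measure \<mu> (ball y r)" if "dist y x < inverse (real (Suc n))" for y
    proof -
      have "ball x (s n) \<subseteq> ball y r"
      proof
        fix z assume "z \<in> ball x (s n)"
        then show "z \<in> ball y r" using that dist_triangle[of y z x] by (auto simp: s_def)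
      qed
      then have "measure \<mu> (ball x (s n)) \<le> measure \<mu> (ball y r)"
        by (intro finite_measure_mono) (auto simp: sets)
      then show ?thesis using n by simp
    qed
    then show "\<exists>e>0. \<forall>y. dist y x < e \<longrightarrow> y \<in> {x. c < measure \<mu> (ball x r)}"
      by (intro exI[of _ "inverse (real (Suc n))"]) auto
  qed
  then show ?thesis by (simp add: closed_def Collect_neg_eq[symmetric] not_le)
qed

text \<open>The upper density bound turns coverings by small sets into coverings by balls of the same
  size, whence the comparison with Hausdorff measure.\<close>

lemma emeasure_le_hausdorff1:
  fixes \<mu> :: "plane measure"
  assumes fin: "finite_measure \<mu>" and sets: "sets \<mu> = sets borel" and B: "B \<in> sets borel"
    and "0 < C"
    and dens: "\<And>x. x \<in> B \<Longrightarrow> \<exists>\<rho>>0. \<forall>r. 0 < r \<and> r < \<rho> \<longrightarrow> measure \<mu> (ball x r) \<le> C * r"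
  shows "emeasure \<mu> B \<le> ennreal C * emeasure hausdorff1 B"
proof -
  interpret finite_measure \<mu> by fact
  define d where "d k = inverse (real (Suc k))" for k
  have d: "0 < d k" for k by (simp add: d_def)
  \<comment> \<open>The density bound holds here uniformly for radii below \<open>d k\<close>; these
    sets increase with k and exhaust B.\<close>
  define F where "F k = {x. \<forall>r. 0 < r \<and> r < d k \<longrightarrow> measure \<mu> (ball x r) \<le> C * r}" for k
  have "F k = (\<Inter>r\<in>{0<..<d k}. {x. measure \<mu> (ball x r) \<le> C * r})" for k by (auto simp: F_def)
  then have "closed (F k)" for k
    by (auto intro!: closed_INT closed_measure_ball_le[OF fin sets])
  then have F [measurable]: "F k \<in> sets \<mu>" for k by (simp add: sets)
  have B' [measurable]: "B \<in> sets \<mu>" using B sets by simp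
  have bound: "emeasure \<mu> (B \<inter> F k) \<le> ennreal C * emeasure hausdorff1 B" for k
  proof -
    \<comment> \<open>At this scale all covering sets have diameters in the range of radii that
      \<open>F k\<close> controls.\<close>
    define \<delta> where "\<delta> = d k / 2"
    have \<delta>: "0 < \<delta>" "\<delta> < d k" using d[of k] by (auto simp: \<delta>_def)
    have "ennreal (1 / C) * emeasure \<mu> (B \<inter> F k) \<le> hausdorff1_premeasure \<delta> B"
      unfolding hausdorff1_premeasure_def
    proof (intro Inf_greatest, clarify)
      fix U :: "nat \<Rightarrow> plane set"
      assume U: "B \<subseteq> (\<Union>i. U i)" "\<forall>i. bounded (U i) \<and> diameter (U i) \<le> \<delta>"
      have "\<exists>V. V \<in> sets \<mu> \<and> U i \<inter> (B \<inter> F k) \<subseteq> V \<and> measure \<mu> V \<le> C * diameter (U i)" for i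
      proof (cases "U i \<inter> (B \<inter> F k) = {}")
        case True
        then show ?thesis using \<open>0 < C\<close> U(2) by (intro exI[of _ "{}"]) (auto simp: diameter_ge_0)
      next
        case False
        then obtain x where x: "x \<in> U i" "x \<in> F k" by auto
        let ?V = "cball x (diameter (U i))"
        have "U i \<subseteq> ?V" using diameter_bounded_bound[of "U i" x] U(2) x by auto
        \<comment> \<open>\<open>F k\<close> speaks of open balls of positive radius, so the closed
          ball, whose radius may be 0, is approached from outside.\<close>
        moreover have "measure \<mu> ?V / C \<le> diameter (U i)"
        proof (rule dense_ge_bounded)
          show "diameter (U i) < d k" using U(2) \<delta> le_less_trans by blast
          fix r assume r: "diameter (U i) < r" "r < d k"
          have "0 < r" using r diameter_ge_0[of "U i"] U(2) by (meson le_less_trans)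
          have "measure \<mu> ?V \<le> measure \<mu> (ball x r)"
            using r by (intro finite_measure_mono) (auto simp: sets)
          also have "\<dots> \<le> C * r" using x(2) r \<open>0 < r\<close> by (simp add: F_def)
          finally show "measure \<mu> ?V / C \<le> r" using \<open>0 < C\<close> by (simp add: field_simps)
        qed
        ultimately show ?thesis using \<open>0 < C\<close> by (intro exI[of _ ?V]) (auto simp: sets field_simps)
      qed
      then have "\<exists>V. \<forall>i. V i \<in> sets \<mu> \<and> U i \<inter> (B \<inter> F k) \<subseteq> V i \<and> measure \<mu> (V i) \<le> C * diameter (U i)"
        by (intro choice allI)
      then obtain V where V: "\<And>i. V i \<in> sets \<mu>" "\<And>i. U i \<inter> (B \<inter> F k) \<subseteq> V i"
        "\<And>i. measure \<mu> (V i) \<le> C * diameter (U i)" by auto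
      have "B \<inter> F k \<subseteq> (\<Union>i. V i)"
      proof
        fix x assume x: "x \<in> B \<inter> F k"
        then obtain i where "x \<in> U i" using U(1) by blast
        then show "x \<in> (\<Union>i. V i)" using V(2)[of i] x by blast
      qed
      then have "emeasure \<mu> (B \<inter> F k) \<le> emeasure \<mu> (\<Union>i. V i)"
        using V(1) by (intro emeasure_mono) auto
      also have "\<dots> \<le> (\<Sum>i. emeasure \<mu> (V i))"
        using V(1) by (intro emeasure_subadditive_countably) auto
      also have "\<dots> \<le> (\<Sum>i. ennreal C * ennreal (diameter (U i)))"
        using V(3) \<open>0 < C\<close> by (intro suminf_le summableI)
          (simp add: emeasure_eq_measure ennreal_leI flip: ennreal_mult')
      also have "\<dots> = ennreal C * (\<Sum>i. ennreal (diameter (U i)))" by simp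
      finally have "ennreal (1 / C) * emeasure \<mu> (B \<inter> F k) \<le>
          ennreal (1 / C) * (ennreal C * (\<Sum>i. ennreal (diameter (U i))))"
        by (intro mult_left_mono) auto
      then show "ennreal (1 / C) * emeasure \<mu> (B \<inter> F k) \<le> (\<Sum>i. ennreal (diameter (U i)))"
        using \<open>0 < C\<close> by (simp add: mult.assoc[symmetric] flip: ennreal_mult')
    qed
    also have "\<dots> \<le> emeasure hausdorff1 B"
      using hausdorff1_premeasure_le_outer[OF \<delta>(1)] by (simp add: emeasure_hausdorff1[OF B])
    finally have "ennreal C * (ennreal (1 / C) * emeasure \<mu> (B \<inter> F k)) \<le> ennreal C * emeasure hausdorff1 B"
      by (intro mult_left_mono) auto
    then show ?thesis
      using \<open>0 < C\<close> by (simp add: mult.assoc[symmetric] flip: ennreal_mult')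
  qed
  have U: "(\<Union>k. B \<inter> F k) = B"
  proof
    show "B \<subseteq> (\<Union>k. B \<inter> F k)"
    proof
      fix x assume "x \<in> B"
      then obtain \<rho> where \<rho>: "0 < \<rho>" "\<And>r. 0 < r \<Longrightarrow> r < \<rho> \<Longrightarrow> measure \<mu> (ball x r) \<le> C * r"
        using dens by blast
      obtain k where "d k < \<rho>" using reals_Archimedean[OF \<rho>(1)] by (auto simp: d_def)
      then have "x \<in> F k" using \<rho>(2) by (auto simp: F_def)
      then show "x \<in> (\<Union>k. B \<inter> F k)" using \<open>x \<in> B\<close> by blast
    qed
  qed auto
  have "incseq (\<lambda>k. B \<inter> F k)"
  proof (rule incseq_SucI)
    have "d (Suc k) \<le> d k" for k by (simp add: d_def)
    then show "B \<inter> F k \<le> B \<inter> F (Suc k)" for k by (force simp: F_def intro: less_le_trans)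
  qed
  then have "(SUP k. emeasure \<mu> (B \<inter> F k)) = emeasure \<mu> (\<Union>k. B \<inter> F k)"
    by (intro SUP_emeasure_incseq) auto
  then have "emeasure \<mu> B = (SUP k. emeasure \<mu> (B \<inter> F k))" unfolding U ..
  also have "\<dots> \<le> ennreal C * emeasure hausdorff1 B" by (intro SUP_least bound)
  finally show ?thesis .
qed

section \<open>From the Gauss--Green measure to the anisotropic perimeter\<close>

lemma abs_inner_le_polar_norm:
  assumes "bounded K" "y \<in> K" "- y \<in> K"
  shows "\<bar>y \<bullet> v\<bar> \<le> polar_norm K v"
proof -
  have "bounded ((\<lambda>y. v \<bullet> y) ` K)"
    by (rule bounded_linear_image[OF assms(1)]) (rule bounded_linear_inner_right)
  then have bdd: "bdd_above ((\<lambda>y. v \<bullet> y) ` K)" by (rule bounded_imp_bdd_above)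
  show ?thesis
    unfolding polar_norm_def using cSUP_upper[OF assms(2) bdd] cSUP_upper[OF assms(3) bdd]
    by (simp add: inner_commute abs_if)
qed

lemma reduced_boundary_properties:
  assumes gg: "gauss_green E (perimeter_measure E) (perimeter_density E)"
  shows "AE x in perimeter_measure E. x \<in> reduced_boundary E \<and> unit_normal E x = perimeter_density E x \<and>
    (\<exists>\<rho>>0. \<forall>r. 0 < r \<and> r < \<rho> \<longrightarrow> measure (perimeter_measure E) (ball x r) \<le> 16 * pi * r)"
proof -
  define \<mu> \<sigma> where "\<mu> = perimeter_measure E" and "\<sigma> = perimeter_density E"
  have sets: "sets \<mu> = sets borel" and \<sigma>: "\<sigma> \<in> borel_measurable borel"
    and nrm: "AE x in \<mu>. norm (\<sigma> x) = 1" and fin: "finite_measure \<mu>"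
    using gg unfolding \<mu>_def \<sigma>_def gauss_green_def by blast+
  have "AE x in \<mu>. norm (\<sigma> x) \<le> 1" using nrm by eventually_elim simp
  from AE_lebesgue_point[OF fin sets \<sigma> this] AE_measure_ball_pos[OF fin sets] nrm
  show ?thesis
    unfolding \<mu>_def[symmetric] \<sigma>_def[symmetric]
  proof eventually_elim
    case (elim x)
    have mean: "mean_normal E x = (\<lambda>r. (LINT y:ball x r|\<mu>. \<sigma> y) /\<^sub>R measure \<mu> (ball x r))"
      by (simp add: mean_normal_def \<mu>_def \<sigma>_def fun_eq_iff)
    have lim: "(mean_normal E x \<longlongrightarrow> \<sigma> x) (at_right 0)" using elim(1) unfolding mean .
    then have 1: "unit_normal E x = \<sigma> x"
      unfolding unit_normal_def by (intro tendsto_Lim) auto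
    have 2: "x \<in> reduced_boundary E"
      unfolding reduced_boundary_def using elim lim by (auto simp: \<mu>_def)
    have "((\<lambda>r. norm (mean_normal E x r)) \<longlongrightarrow> 1) (at_right 0)"
      using tendsto_norm[OF lim] elim(3) by simp
    \<comment> \<open>The limit is a unit vector, so there is little cancellation on small balls:
      the vector measure keeps more than half of the total variation, which doubles 8 pi to 16
      pi.\<close>
    then have "\<forall>\<^sub>F r in at_right 0. 1 / 2 < norm (mean_normal E x r)"
      by (rule order_tendstoD) simp
    then obtain \<rho> where \<rho>: "0 < \<rho>" "\<And>r. 0 < r \<Longrightarrow> r < \<rho> \<Longrightarrow> 1 / 2 < norm (mean_normal E x r)"
      unfolding eventually_at_right_field by blast
    have "measure \<mu> (ball x r) \<le> 16 * pi * r" if r: "0 < r" "r < \<rho>" for r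
    proof -
      have m: "0 < measure \<mu> (ball x r)" using elim(2) r by simp
      have "measure \<mu> (ball x r) / 2 < norm (LINT y:ball x r|\<mu>. \<sigma> y)"
        using \<rho>(2)[OF r] m by (simp add: mean field_simps)
      also have "\<dots> \<le> 8 * pi * r"
        using gauss_green_ball_bound[OF gg r(1)] by (simp add: \<mu>_def \<sigma>_def)
      finally show ?thesis by simp
    qed
    with \<rho>(1) 1 2 show ?case by blast
  qed
qed

text \<open>As y and - y lie in K, the integrand is at least norm y times the component of the
  normal along y, and \<open>gauss_green_measure_le\<close> applies in that direction. The constant
  32 pi R is 2 R times 16 pi.\<close>

lemma aniso_perimeter_lower_bound:
  assumes K: "bounded K" "y \<in> K" "- y \<in> K" and E: "E \<in> sets borel" "E \<subseteq> ball 0 R" and "0 < R"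
  shows "ennreal (norm y / (32 * pi * R)) * emeasure lborel E \<le> aniso_perimeter K E"
proof (cases "finite_perimeter E \<and> y \<noteq> 0")
  case False
  then show ?thesis by (auto simp: aniso_perimeter_def)
next
  case True
  define \<mu> \<sigma> where "\<mu> = perimeter_measure E" and "\<sigma> = perimeter_density E"
  have "\<exists>\<mu> \<sigma>. gauss_green E \<mu> \<sigma>" using True by (auto simp: finite_perimeter_def)
  then have "\<exists>\<sigma>. gauss_green E \<mu> \<sigma>" unfolding \<mu>_def perimeter_measure_def by (rule someI_ex)
  then have gg: "gauss_green E \<mu> \<sigma>"
    unfolding \<sigma>_def perimeter_density_def \<mu>_def[symmetric] by (rule someI_ex)
  then have sets [measurable_cong]: "sets \<mu> = sets borel" and \<sigma> [measurable]: "\<sigma> \<in> borel_measurable borel"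
    and nrm: "AE x in \<mu>. norm (\<sigma> x) = 1" and fin: "finite_measure \<mu>"
    by (auto simp: gauss_green_def)
  interpret finite_measure \<mu> by fact
  have spc: "space \<mu> = UNIV" using sets_eq_imp_space_eq[OF sets] by simp
  have "AE x in \<mu>. x \<in> reduced_boundary E \<and> unit_normal E x = \<sigma> x \<and>
    (\<exists>\<rho>>0. \<forall>r. 0 < r \<and> r < \<rho> \<longrightarrow> measure \<mu> (ball x r) \<le> 16 * pi * r)"
    using reduced_boundary_properties[of E] gg unfolding \<mu>_def \<sigma>_def by blast
  \<comment> \<open>The set of good points is not known to be measurable; it is replaced by the
    complement A of a measurable null set.\<close>
  then obtain N where N': "{x \<in> space \<mu>. \<not> (x \<in> reduced_boundary E \<and> unit_normal E x = \<sigma> x \<and>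
      (\<exists>\<rho>>0. \<forall>r. 0 < r \<and> r < \<rho> \<longrightarrow> measure \<mu> (ball x r) \<le> 16 * pi * r))} \<subseteq> N"
    and N: "emeasure \<mu> N = 0" "N \<in> sets \<mu>"
    by (rule AE_E)
  have good: "x \<in> reduced_boundary E" "unit_normal E x = \<sigma> x"
    "\<exists>\<rho>>0. \<forall>r. 0 < r \<and> r < \<rho> \<longrightarrow> measure \<mu> (ball x r) \<le> 16 * pi * r" if "x \<notin> N" for x
    using N' that unfolding spc by blast+
  define A where "A = - N"
  have A [measurable]: "A \<in> sets borel" using N(2) by (auto simp: A_def sets)
  have y0: "y \<noteq> 0" using True by simp
  define e where "e = sgn y"
  have e: "norm e = 1" using True by (simp add: e_def norm_sgn)
  define f where "f x = ennreal \<bar>e \<bullet> \<sigma> x\<bar>" for x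
  have f [measurable]: "f \<in> borel_measurable borel" unfolding f_def by measurable
  \<comment> \<open>Stated as an inequality between measures, the domination passes directly to
    integrals.\<close>
  have le: "density \<mu> (indicator A) \<le> scale_measure (ennreal (16 * pi)) hausdorff1"
  proof (subst le_measure)
    show "sets (density \<mu> (indicator A)) = sets (scale_measure (ennreal (16 * pi)) hausdorff1)"
      by (simp add: sets)
    show "\<forall>X\<in>sets (density \<mu> (indicator A)).
        emeasure (density \<mu> (indicator A)) X \<le> emeasure (scale_measure (ennreal (16 * pi)) hausdorff1) X"
    proof
      fix X assume "X \<in> sets (density \<mu> (indicator A))"
      then have X: "X \<in> sets borel" by (simp add: sets)
      have "emeasure (density \<mu> (indicator A)) X = emeasure \<mu> (A \<inter> X)"
        using X by (intro emeasure_restricted) (auto simp: sets)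
      also have "\<dots> \<le> ennreal (16 * pi) * emeasure hausdorff1 (A \<inter> X)"
        by (intro emeasure_le_hausdorff1[OF fin sets]) (use X A good in \<open>auto simp: A_def\<close>)
      also have "\<dots> \<le> ennreal (16 * pi) * emeasure hausdorff1 X"
        using X by (intro mult_left_mono emeasure_mono) auto
      finally show "emeasure (density \<mu> (indicator A)) X \<le> emeasure (scale_measure (ennreal (16 * pi)) hausdorff1) X"
        by simp
    qed
  qed
  \<comment> \<open>One indicator becomes the density. The other stays in the integrand because N
    need not be null for \<open>hausdorff1\<close>.\<close>
  have "(\<integral>\<^sup>+x. f x \<partial>\<mu>) = (\<integral>\<^sup>+x. indicator A x * (f x * indicator A x) \<partial>\<mu>)"
  proof (rule nn_integral_cong_AE)
    have "AE x in \<mu>. x \<notin> N" using N by (intro AE_not_in null_setsI)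
    then show "AE x in \<mu>. f x = indicator A x * (f x * indicator A x)"
      by eventually_elim (simp add: A_def)
  qed
  also have "\<dots> = (\<integral>\<^sup>+x. f x * indicator A x \<partial>density \<mu> (indicator A))"
    by (rule nn_integral_density[symmetric]) measurable
  also have "\<dots> \<le> (\<integral>\<^sup>+x. f x * indicator A x \<partial>scale_measure (ennreal (16 * pi)) hausdorff1)"
    by (rule nn_integral_mono_measure[OF _ le]) (simp add: sets)
  also have "\<dots> = ennreal (16 * pi) * (\<integral>\<^sup>+x. f x * indicator A x \<partial>hausdorff1)"
    by (rule nn_integral_scale_measure) measurable
  finally have f_le: "(\<integral>\<^sup>+x. f x \<partial>\<mu>) \<le> ennreal (16 * pi) * (\<integral>\<^sup>+x. f x * indicator A x \<partial>hausdorff1)" .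
  have int: "integrable \<mu> (\<lambda>x. \<bar>e \<bullet> \<sigma> x\<bar>)"
  proof (rule integrable_const_bound)
    show "AE x in \<mu>. norm \<bar>e \<bullet> \<sigma> x\<bar> \<le> 1"
      using nrm
    proof eventually_elim
      case (elim x)
      then show ?case using Cauchy_Schwarz_ineq2[of e "\<sigma> x"] e by simp
    qed
  qed measurable
  have finE: "emeasure lborel E < \<infinity>"
    using E(2) by (intro emeasure_bounded_finite bounded_subset[OF bounded_ball])
  define c where "c = norm y / (32 * pi * R)"
  have "0 \<le> c" using \<open>0 < R\<close> by (simp add: c_def)
  have "ennreal c * emeasure lborel E = ennreal c * ennreal (measure lborel E)"
    using finE by (simp add: emeasure_eq_ennreal_measure)
  also have "\<dots> \<le> ennreal c * ennreal (2 * R * (\<integral>x. \<bar>e \<bullet> \<sigma> x\<bar> \<partial>\<mu>))"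
    by (intro mult_left_mono ennreal_leI gauss_green_measure_le[OF gg E \<open>0 < R\<close> e]) auto
  also have "\<dots> = ennreal (c * 2 * R) * (\<integral>\<^sup>+x. f x \<partial>\<mu>)"
    unfolding f_def using int \<open>0 \<le> c\<close> \<open>0 < R\<close>
    by (subst nn_integral_eq_integral) (auto simp: ac_simps simp flip: ennreal_mult)
  also have "\<dots> \<le> ennreal (c * 2 * R) * (ennreal (16 * pi) * (\<integral>\<^sup>+x. f x * indicator A x \<partial>hausdorff1))"
    by (intro mult_left_mono f_le) auto
  also have "\<dots> = ennreal (norm y) * (\<integral>\<^sup>+x. f x * indicator A x \<partial>hausdorff1)"
    using \<open>0 \<le> c\<close> \<open>0 < R\<close> by (simp add: mult.assoc[symmetric] c_def flip: ennreal_mult)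
  also have "\<dots> = (\<integral>\<^sup>+x. ennreal (norm y) * (f x * indicator A x) \<partial>hausdorff1)"
    by (rule nn_integral_cmult[symmetric]) measurable
  also have "\<dots> \<le> (\<integral>\<^sup>+x\<in>reduced_boundary E. ennreal (polar_norm K (unit_normal E x)) \<partial>hausdorff1)"
  proof (intro nn_integral_mono)
    fix x
    show "ennreal (norm y) * (f x * indicator A x) \<le>
        ennreal (polar_norm K (unit_normal E x)) * indicator (reduced_boundary E) x"
    proof (cases "x \<in> A")
      case True
      then have x: "x \<in> reduced_boundary E" "unit_normal E x = \<sigma> x" using good by (auto simp: A_def)
      have "y = norm y *\<^sub>R e" using y0 by (simp add: e_def sgn_div_norm)
      then have "norm y * \<bar>e \<bullet> \<sigma> x\<bar> = \<bar>y \<bullet> \<sigma> x\<bar>"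
        by (metis abs_mult abs_norm_cancel inner_scaleR_left)
      also have "\<dots> \<le> polar_norm K (\<sigma> x)" by (rule abs_inner_le_polar_norm[OF K])
      finally show ?thesis using True x by (simp add: f_def ennreal_leI flip: ennreal_mult)
    qed simp
  qed
  also have "\<dots> = aniso_perimeter K E" using True by (simp add: aniso_perimeter_def)
  finally show ?thesis unfolding c_def .
qed

lemma cheeger_const_lower_bound:
  assumes K: "bounded K" "y \<in> K" "- y \<in> K" and \<Omega>: "\<Omega> \<subseteq> ball 0 R" and "0 < R"
  shows "ennreal (norm y / (32 * pi * R)) \<le> cheeger_const K \<Omega>"
  unfolding cheeger_const_def
proof (intro Inf_greatest, clarify)
  fix E :: "plane set" assume E: "E \<in> sets borel" "E \<subseteq> \<Omega>" "0 < emeasure lborel E"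
  have fin: "emeasure lborel E < \<infinity>"
    using E(2) \<Omega> by (intro emeasure_bounded_finite bounded_subset[OF bounded_ball[of 0 R]]) auto
  let ?c = "ennreal (norm y / (32 * pi * R))"
  have "?c = ?c * emeasure lborel E / emeasure lborel E"
    using E(3) fin by (simp add: ennreal_mult_divide_eq)
  also have "\<dots> \<le> aniso_perimeter K E / emeasure lborel E"
    using E(2) \<Omega> by (intro divide_right_mono_ennreal aniso_perimeter_lower_bound[OF K E(1) _ \<open>0 < R\<close>]) auto
  finally show "?c \<le> aniso_perimeter K E / emeasure lborel E" .
qed

section \<open>Comparison and compactness of convex bodies\<close>

text \<open>The integrand of the anisotropic perimeter is not known to be measurable, which rules out
  \<open>nn_integral_cmult\<close>.\<close>

lemma nn_integral_cmult_le:
  assumes "0 < c"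
  shows "(\<integral>\<^sup>+x. ennreal c * f x \<partial>M) \<le> ennreal c * (\<integral>\<^sup>+x. f x \<partial>M)"
  unfolding nn_integral_def[of M "\<lambda>x. ennreal c * f x"]
proof (rule SUP_least)
  fix g assume "g \<in> {g. simple_function M g \<and> g \<le> (\<lambda>x. ennreal c * f x)}"
  then have g: "simple_function M g" "\<And>x. g x \<le> ennreal c * f x" by (auto simp: le_fun_def)
  \<comment> \<open>Dividing by c turns a simple function below c f into one below f.\<close>
  define h where "h x = ennreal (1 / c) * g x" for x
  have inv: "ennreal (1 / c) * (ennreal c * a) = a" "ennreal c * (ennreal (1 / c) * a) = a" for a
    using assms by (simp_all add: mult.assoc[symmetric] flip: ennreal_mult')
  have h: "simple_function M h" unfolding h_def using g(1) by auto
  have hf: "h x \<le> f x" for x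
    using mult_left_mono[OF g(2)[of x], of "ennreal (1 / c)"] by (simp add: h_def inv)
  have "integral\<^sup>S M g = integral\<^sup>S M (\<lambda>x. ennreal c * h x)" by (simp add: h_def inv)
  also have "\<dots> = ennreal c * integral\<^sup>S M h" using h by simp
  also have "integral\<^sup>S M h = (\<integral>\<^sup>+x. h x \<partial>M)" using h by (simp add: nn_integral_eq_simple_integral)
  also have "ennreal c * \<dots> \<le> ennreal c * (\<integral>\<^sup>+x. f x \<partial>M)"
    by (intro mult_left_mono nn_integral_mono hf) auto
  finally show "integral\<^sup>S M g \<le> ennreal c * (\<integral>\<^sup>+x. f x \<partial>M)" .
qed

lemma aniso_perimeter_le_mult:
  assumes "0 < a" and le: "\<And>v. polar_norm K' v \<le> a * polar_norm K v"
  shows "aniso_perimeter K' E \<le> ennreal a * aniso_perimeter K E"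
proof (cases "finite_perimeter E")
  case True
  have "(\<integral>\<^sup>+x\<in>reduced_boundary E. ennreal (polar_norm K' (unit_normal E x)) \<partial>hausdorff1) \<le>
    (\<integral>\<^sup>+x. ennreal a * (ennreal (polar_norm K (unit_normal E x)) * indicator (reduced_boundary E) x) \<partial>hausdorff1)"
    using le assms by (intro nn_integral_mono) (auto simp: indicator_def ennreal_leI simp flip: ennreal_mult')
  also have "\<dots> \<le> ennreal a * (\<integral>\<^sup>+x\<in>reduced_boundary E. ennreal (polar_norm K (unit_normal E x)) \<partial>hausdorff1)"
    by (rule nn_integral_cmult_le[OF assms(1)])
  finally show ?thesis using True by (simp add: aniso_perimeter_def)
next
  case False
  then show ?thesis using assms by (simp add: aniso_perimeter_def ennreal_mult_top)
qed

lemma cheeger_const_le_mult: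
  assumes "0 < a" and le: "\<And>v. polar_norm K' v \<le> a * polar_norm K v"
  shows "cheeger_const K' \<Omega> \<le> ennreal a * cheeger_const K \<Omega>"
proof -
  have inv: "ennreal (1 / a) * (ennreal a * b) = b" "ennreal a * (ennreal (1 / a) * b) = b" for b
    using assms by (simp_all add: mult.assoc[symmetric] flip: ennreal_mult')
  have "ennreal (1 / a) * cheeger_const K' \<Omega> \<le> cheeger_const K \<Omega>"
    unfolding cheeger_const_def[of K]
  proof (intro Inf_greatest, clarify)
    fix E :: "plane set" assume E: "E \<in> sets borel" "E \<subseteq> \<Omega>" "0 < emeasure lborel E"
    have "cheeger_const K' \<Omega> \<le> aniso_perimeter K' E / emeasure lborel E"
      unfolding cheeger_const_def using E by (intro Inf_lower) auto
    also have "\<dots> \<le> ennreal a * aniso_perimeter K E / emeasure lborel E"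
      by (intro divide_right_mono_ennreal aniso_perimeter_le_mult assms)
    also have "\<dots> = ennreal a * (aniso_perimeter K E / emeasure lborel E)"
      by (simp add: ennreal_times_divide)
    finally have "ennreal (1 / a) * cheeger_const K' \<Omega> \<le>
        ennreal (1 / a) * (ennreal a * (aniso_perimeter K E / emeasure lborel E))"
      by (intro mult_left_mono) auto
    then show "ennreal (1 / a) * cheeger_const K' \<Omega> \<le> aniso_perimeter K E / emeasure lborel E"
      by (simp add: inv)
  qed
  then have "ennreal a * (ennreal (1 / a) * cheeger_const K' \<Omega>) \<le> ennreal a * cheeger_const K \<Omega>"
    by (intro mult_left_mono) auto
  then show ?thesis by (simp add: inv)
qed

section \<open>Polar bodies, their area and inclusions between bodies\<close>

lemma sym_convex_bodiesD:
  assumes "K \<in> sym_convex_bodies"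
  shows "K \<noteq> {}" "open K" "bounded K" "convex K" "\<And>x. x \<in> K \<Longrightarrow> - x \<in> K" "0 \<in> K"
proof -
  show *: "K \<noteq> {}" "open K" "bounded K" "convex K" "\<And>x. x \<in> K \<Longrightarrow> - x \<in> K"
    using assms by (auto simp: sym_convex_bodies_def)
  obtain x where "x \<in> K" using *(1) by blast
  then have "(1 / 2) *\<^sub>R x + (1 / 2) *\<^sub>R (- x) \<in> K" using * by (intro convexD) auto
  then show "0 \<in> K" by simp
qed

lemma sym_convex_bodies_ball:
  assumes "K \<in> sym_convex_bodies"
  obtains r where "0 < r" "ball 0 r \<subseteq> K"
  using sym_convex_bodiesD[OF assms] open_contains_ball by blast

lemma inner_le_polar_norm:
  assumes "bounded K" "y \<in> K"
  shows "x \<bullet> y \<le> polar_norm K x"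
proof -
  have "bounded ((\<lambda>y. x \<bullet> y) ` K)"
    by (rule bounded_linear_image[OF assms(1)]) (rule bounded_linear_inner_right)
  then show ?thesis
    unfolding polar_norm_def by (intro cSUP_upper assms(2) bounded_imp_bdd_above)
qed

lemma polar_norm_le:
  assumes "K \<noteq> {}" "\<And>y. y \<in> K \<Longrightarrow> x \<bullet> y \<le> c"
  shows "polar_norm K x \<le> c"
  unfolding polar_norm_def using assms by (intro cSUP_least)

lemma polar_norm_le_mult:
  assumes "K' \<noteq> {}" "bounded K" "K' \<subseteq> (*\<^sub>R) a ` K" "0 \<le> a"
  shows "polar_norm K' v \<le> a * polar_norm K v"
proof (rule polar_norm_le[OF assms(1)])
  fix y assume "y \<in> K'"
  then obtain x where "x \<in> K" "y = a *\<^sub>R x" using assms(3) by auto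
  then show "v \<bullet> y \<le> a * polar_norm K v"
    using inner_le_polar_norm[OF assms(2), of x v] assms(4) by (simp add: mult_left_mono)
qed

lemma inner_sgn_self: "x \<bullet> sgn x = norm x"
  for x :: "'a::real_inner"
  by (cases "x = 0") (auto simp: sgn_div_norm dot_square_norm power2_eq_square)

text \<open>A nonzero linear functional has no maximum on an open set, since y can be moved towards
  \<open>sgn x\<close>. The strict inequalities may therefore be relaxed to closed
  half-spaces.\<close>

lemma closed_polar:
  assumes "open K"
  shows "closed (polar K)"
proof -
  have "polar K = (\<Inter>y\<in>K. {x. y \<bullet> x \<le> 1})"
  proof
    show "(\<Inter>y\<in>K. {x. y \<bullet> x \<le> 1}) \<subseteq> polar K"
    proof
      fix x assume x: "x \<in> (\<Inter>y\<in>K. {x. y \<bullet> x \<le> 1})"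
      show "x \<in> polar K"
        unfolding polar_def
      proof safe
        fix y assume "y \<in> K"
        show "x \<bullet> y < 1"
        proof (rule ccontr)
          assume "\<not> x \<bullet> y < 1"
          then have 1: "x \<bullet> y = 1" using x \<open>y \<in> K\<close> by (auto simp: inner_commute)
          obtain e where e: "0 < e" "cball y e \<subseteq> K" using assms \<open>y \<in> K\<close> open_contains_cball by blast
          have "y + e *\<^sub>R sgn x \<in> K" using e by (auto simp: subset_eq dist_norm norm_sgn)
          then have "x \<bullet> (y + e *\<^sub>R sgn x) \<le> 1" using x by (auto simp: inner_commute)
          moreover have "0 < x \<bullet> sgn x" using 1 by (auto simp: inner_sgn_self)
          ultimately show False using 1 mult_pos_pos[OF e(1)] by (force simp: inner_add_right)
        qed
      qed
    qed
  qed (auto simp: polar_def inner_commute intro: less_imp_le)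
  then show ?thesis by (auto intro!: closed_INT closed_halfspace_le)
qed

lemma bounded_polar:
  assumes "K \<in> sym_convex_bodies"
  shows "bounded (polar K)"
proof -
  obtain r where r: "0 < r" "ball 0 r \<subseteq> K" by (rule sym_convex_bodies_ball[OF assms])
  have "norm x \<le> 2 / r" if "x \<in> polar K" for x
  proof -
    have "(r / 2) *\<^sub>R sgn x \<in> K" using r by (intro subsetD[OF r(2)]) (auto simp: norm_sgn)
    then have "x \<bullet> ((r / 2) *\<^sub>R sgn x) < 1" using that by (auto simp: polar_def)
    then have "r / 2 * norm x < 1" by (simp add: inner_sgn_self)
    then show ?thesis using r(1) by (simp add: field_simps)
  qed
  then show ?thesis by (auto simp: bounded_iff)
qed

text \<open>Polarity reverses inclusions, so the polar of K' lies in 1 / s times that of K, and area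
  scales quadratically.\<close>

lemma measure_polar_le:
  assumes K: "K \<in> sym_convex_bodies" "K' \<in> sym_convex_bodies" and "0 < s" "(*\<^sub>R) s ` K \<subseteq> K'"
  shows "measure lborel (polar K') \<le> measure lborel (polar K) / s\<^sup>2"
proof -
  have c: "closed (polar K)" "closed (polar K')"
    using K by (auto intro: closed_polar dest: sym_convex_bodiesD)
  have cb: "compact (polar K)"
    using c(1) bounded_polar[OF K(1)] by (simp add: compact_eq_bounded_closed)
  \<comment> \<open>The summand 0 gives the map the form that \<open>measure_lebesgue_affine\<close>
    expects.\<close>
  have sub: "polar K' \<subseteq> (\<lambda>x. (1 / s) *\<^sub>R x + 0) ` polar K"
  proof
    fix x assume x: "x \<in> polar K'"
    have "s *\<^sub>R x \<in> polar K"
      unfolding polar_def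
    proof safe
      fix y assume "y \<in> K"
      then have "s *\<^sub>R y \<in> K'" using assms(4) by blast
      then show "s *\<^sub>R x \<bullet> y < 1" using x by (auto simp: polar_def)
    qed
    then show "x \<in> (\<lambda>x. (1 / s) *\<^sub>R x + 0) ` polar K"
      using \<open>0 < s\<close> by (intro image_eqI[where x = "s *\<^sub>R x"]) auto
  qed
  have cs: "compact ((\<lambda>x. (1 / s) *\<^sub>R x + 0) ` polar K)"
    by (intro compact_continuous_image cb continuous_intros)
  have "measure lborel (polar K') \<le> measure lborel ((\<lambda>x. (1 / s) *\<^sub>R x + 0) ` polar K)"
  proof (rule measure_mono_fmeasurable[OF sub])
    show "(\<lambda>x. (1 / s) *\<^sub>R x + 0) ` polar K \<in> fmeasurable lborel"
      using cs by (rule fmeasurable_compact)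
  qed (use c in auto)
  also have "\<dots> = measure lebesgue ((\<lambda>x. (1 / s) *\<^sub>R x + 0) ` polar K)"
    using cs by (simp add: borel_compact)
  also have "\<dots> = measure lebesgue (polar K) / s\<^sup>2"
    by (subst measure_lebesgue_affine) (simp add: power_divide)
  also have "measure lebesgue (polar K) = measure lborel (polar K)"
    using c by simp
  finally show ?thesis .
qed

text \<open>The outer inclusion controls the Cheeger constant and the inner one the polar area,
  whose square root contributes 1 / s.\<close>

lemma cheeger_functional_le_mult:
  assumes K: "K \<in> sym_convex_bodies" "K' \<in> sym_convex_bodies" and "0 < s" "0 < a"
    and sub: "(*\<^sub>R) s ` K \<subseteq> K'" "K' \<subseteq> (*\<^sub>R) a ` K"
  shows "cheeger_functional \<Omega> K' \<le> ennreal (a / s) * cheeger_functional \<Omega> K"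
proof -
  have "cheeger_const K' \<Omega> \<le> ennreal a * cheeger_const K \<Omega>"
    using K sub assms(4) by (intro cheeger_const_le_mult polar_norm_le_mult) (auto dest: sym_convex_bodiesD)
  moreover have "sqrt (measure lborel (polar K')) \<le> (1 / s) * sqrt (measure lborel (polar K))"
    using real_sqrt_le_mono[OF measure_polar_le[OF K \<open>0 < s\<close> sub(1)]] \<open>0 < s\<close>
    by (simp add: real_sqrt_divide)
  ultimately have "cheeger_functional \<Omega> K' \<le>
      (ennreal a * cheeger_const K \<Omega>) * ennreal ((1 / s) * sqrt (measure lborel (polar K)))"
    unfolding cheeger_functional_def by (intro mult_mono ennreal_leI) auto
  also have "ennreal ((1 / s) * sqrt (measure lborel (polar K))) =
      ennreal (1 / s) * ennreal (sqrt (measure lborel (polar K)))"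
    using \<open>0 < s\<close> by (intro ennreal_mult) auto
  also have "(ennreal a * cheeger_const K \<Omega>) * \<dots> = (ennreal a * ennreal (1 / s)) * cheeger_functional \<Omega> K"
    by (simp only: cheeger_functional_def ac_simps)
  also have "ennreal a * ennreal (1 / s) = ennreal (a / s)"
    using assms by (simp flip: ennreal_mult)
  finally show ?thesis .
qed

text \<open>A rectangle centred at 0 with sides norm z and 1 fits into the polar. Its points average
  z and an orthogonal unit vector w with weights at most 1 / 2 in absolute value; on K the
  functional z is below 1 in absolute value by symmetry, and w is at most 1 because K lies in the
  unit ball.\<close>

lemma norm_le_measure_polar:
  assumes K: "K \<in> sym_convex_bodies" and sub: "K \<subseteq> cball 0 1" and z: "z \<in> polar K"
  shows "norm z \<le> measure lborel (polar K)"
proof (cases "z = 0")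
  case False
  \<comment> \<open>The direction of z turned by 90 degrees.\<close>
  define w :: plane where "w = vector [- (z $ 2) / norm z, z $ 1 / norm z]"
  have w: "w $ 1 = - (z $ 2) / norm z" "w $ 2 = z $ 1 / norm z" by (simp_all add: w_def)
  define f where "f v = v $ 1 *\<^sub>R z + v $ 2 *\<^sub>R w" for v :: plane
  have lin: "linear f" by (rule linearI) (simp_all add: f_def algebra_simps)
  have nz: "(z $ 1)\<^sup>2 + (z $ 2)\<^sup>2 = (norm z)\<^sup>2" by (rule norm_plane[symmetric])
  have "(norm w)\<^sup>2 = ((z $ 1)\<^sup>2 + (z $ 2)\<^sup>2) / (norm z)\<^sup>2"
    by (simp add: norm_plane[of w] w power_divide add_divide_distrib)
  also have "\<dots> = 1" unfolding nz using False by simp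
  finally have "(norm w)\<^sup>2 = 1" .
  then have w1: "norm w = 1" using norm_ge_zero[of w] unfolding power2_eq_1_iff by linarith
  have "det (matrix f) = z $ 1 * w $ 2 - w $ 1 * z $ 2"
    by (simp add: det_2 matrix_def f_def axis_def)
  also have "\<dots> = ((z $ 1)\<^sup>2 + (z $ 2)\<^sup>2) / norm z"
    by (simp add: w power2_eq_square add_divide_distrib)
  also have "\<dots> = norm z" unfolding nz using False by (simp add: power2_eq_square)
  finally have det: "det (matrix f) = norm z" .
  define S where "S = cbox (vec (- 1 / 2)) (vec (1 / 2) :: plane)"
  have S: "measure lebesgue S = 1"
  proof -
    have "S \<noteq> {}" unfolding S_def by (simp add: interval_ne_empty_cart)
    then have "measure lborel S = 1" unfolding S_def by (subst content_cbox_cart) (auto simp: UNIV_2)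
    then show ?thesis by (simp add: S_def)
  qed
  have sub: "f ` S \<subseteq> polar K"
  proof
    fix x assume "x \<in> f ` S"
    then obtain v where v: "x = f v" "v \<in> S" by auto
    have v': "\<bar>v $ 1\<bar> \<le> 1 / 2" "\<bar>v $ 2\<bar> \<le> 1 / 2"
      using v(2) by (auto simp: S_def mem_box_cart forall_2 abs_le_iff)
    show "x \<in> polar K"
      unfolding polar_def
    proof safe
      fix y assume y: "y \<in> K"
      have "z \<bullet> y < 1" "z \<bullet> (- y) < 1"
        using z y sym_convex_bodiesD(5)[OF K y] by (auto simp: polar_def)
      then have "\<bar>z \<bullet> y\<bar> < 1" by (simp add: abs_less_iff)
      moreover have "\<bar>w \<bullet> y\<bar> \<le> 1"
        using Cauchy_Schwarz_ineq2[of w y] w1 y sub by force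
      moreover have "x \<bullet> y \<le> \<bar>v $ 1\<bar> * \<bar>z \<bullet> y\<bar> + \<bar>v $ 2\<bar> * \<bar>w \<bullet> y\<bar>"
        unfolding v f_def inner_add_left inner_scaleR_left abs_mult[symmetric] by (intro add_mono abs_ge_self)
      moreover have "\<bar>v $ 1\<bar> * \<bar>z \<bullet> y\<bar> \<le> 1 / 2 * \<bar>z \<bullet> y\<bar>" "\<bar>v $ 2\<bar> * \<bar>w \<bullet> y\<bar> \<le> 1 / 2 * \<bar>w \<bullet> y\<bar>"
        using v' by (intro mult_right_mono abs_ge_zero; simp)+
      ultimately show "x \<bullet> y < 1" by linarith
    qed
  qed
  have cl: "closed (polar K)" using K by (auto intro: closed_polar dest: sym_convex_bodiesD)
  then have "compact (polar K)"
    using bounded_polar[OF K] by (simp add: compact_eq_bounded_closed)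
  then have meas: "polar K \<in> lmeasurable" by (rule lmeasurable_compact)
  have Sm: "S \<in> lmeasurable" by (simp add: S_def)
  have "norm z = measure lebesgue (f ` S)"
    by (simp add: measure_linear_image[OF lin Sm] det S)
  also have "\<dots> \<le> measure lebesgue (polar K)"
    by (rule measure_mono_fmeasurable[OF sub fmeasurableD[OF measurable_linear_image[OF lin Sm]] meas])
  also have "\<dots> = measure lborel (polar K)" using cl by simp
  finally show ?thesis .
qed simp

text \<open>A separating functional, rescaled to equal 1 at x. Openness of K gives the strict
  inequality that \<open>polar\<close> demands.\<close>

lemma polar_separation:
  assumes K: "K \<in> sym_convex_bodies" and x: "x \<notin> K"
  obtains z where "z \<in> polar K" "z \<bullet> x = 1"
proof -
  note K' = sym_convex_bodiesD[OF K]
  obtain a b where ab: "a \<noteq> 0" "\<And>y. y \<in> K \<Longrightarrow> a \<bullet> y \<le> b" "b \<le> a \<bullet> x"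
    using separating_hyperplane_sets[of K "{x}"] K' x by auto
  have strict: "a \<bullet> y < a \<bullet> x" if "y \<in> K" for y
  proof -
    obtain e where e: "0 < e" "cball y e \<subseteq> K" using K'(2) \<open>y \<in> K\<close> open_contains_cball by blast
    have "y + e *\<^sub>R sgn a \<in> K" using e by (auto simp: subset_eq dist_norm norm_sgn)
    then have "a \<bullet> y + e * (a \<bullet> sgn a) \<le> a \<bullet> x" using ab(2,3) by (force simp: inner_add_right)
    moreover have "0 < a \<bullet> sgn a" using ab(1) by (simp add: inner_sgn_self)
    ultimately show ?thesis using e(1) by (smt (verit) mult_pos_pos)
  qed
  have pos: "0 < a \<bullet> x" using strict[OF K'(6)] by simp
  show ?thesis
  proof
    show "(1 / (a \<bullet> x)) *\<^sub>R a \<in> polar K" using strict pos by (auto simp: polar_def field_simps)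
    show "((1 / (a \<bullet> x)) *\<^sub>R a) \<bullet> x = 1" using pos by simp
  qed
qed

text \<open>If x / c were outside B, a separating direction u would bound the support function of A
  by u \<bullet> x, but x is interior to A. Unit vectors suffice, matching uniform convergence on
  the circle.\<close>

lemma subset_scaleR_if_polar_norm_le:
  assumes K: "A \<in> sym_convex_bodies" "B \<in> sym_convex_bodies" and "0 < c"
    and le: "\<And>u. norm u = 1 \<Longrightarrow> polar_norm A u \<le> c * polar_norm B u"
  shows "A \<subseteq> (*\<^sub>R) c ` B"
proof
  fix x assume x: "x \<in> A"
  have "x /\<^sub>R c \<in> B"
  proof (rule ccontr)
    assume "x /\<^sub>R c \<notin> B"
    then obtain z where z: "z \<in> polar B" "z \<bullet> (x /\<^sub>R c) = 1" by (rule polar_separation[OF K(2)])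
    then have z0: "z \<noteq> 0" and zx: "z \<bullet> x = c" using \<open>0 < c\<close> by (auto simp: field_simps)
    define u where "u = sgn z"
    have u: "norm u = 1" "z = norm z *\<^sub>R u" using z0 by (simp_all add: u_def norm_sgn sgn_div_norm)
    have inner_z: "z \<bullet> y = norm z * (u \<bullet> y)" for y by (subst u(2)) simp
    have "polar_norm B u \<le> 1 / norm z"
    proof (rule polar_norm_le)
      fix y assume "y \<in> B"
      then have "norm z * (u \<bullet> y) < 1" using z(1) inner_z by (auto simp: polar_def)
      then show "u \<bullet> y \<le> 1 / norm z" using z0 by (simp add: field_simps)
    qed (use K(2) in \<open>simp add: sym_convex_bodies_def\<close>)
    then have "polar_norm A u \<le> c / norm z"
      using le[OF u(1)] mult_left_mono[of "polar_norm B u" "1 / norm z" c] \<open>0 < c\<close> by simp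
    moreover have "c / norm z < polar_norm A u"
    proof -
      obtain e where e: "0 < e" "cball x e \<subseteq> A"
        using x sym_convex_bodiesD(2)[OF K(1)] open_contains_cball by blast
      have "x + e *\<^sub>R u \<in> A" using e u(1) by (auto simp: subset_eq dist_norm)
      then have "u \<bullet> (x + e *\<^sub>R u) \<le> polar_norm A u"
        using sym_convex_bodiesD(3)[OF K(1)] by (rule inner_le_polar_norm[rotated])
      moreover have "u \<bullet> x = c / norm z" using zx inner_z[of x] z0 by (simp add: field_simps)
      moreover have "u \<bullet> u = 1" using u(1) by (simp add: dot_square_norm)
      ultimately show ?thesis using e(1) by (simp add: inner_add_right)
    qed
    ultimately show False by simp
  qed
  then show "x \<in> (*\<^sub>R) c ` B" using \<open>0 < c\<close> by (intro image_eqI[where x = "x /\<^sub>R c"]) auto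
qed

section \<open>Blaschke selection\<close>

lemma polar_norm_lipschitz:
  assumes "K \<noteq> {}" "K \<subseteq> cball 0 1"
  shows "\<bar>polar_norm K u - polar_norm K v\<bar> \<le> norm (u - v)"
proof -
  have bdd: "bounded K" using assms(2) bounded_subset by blast
  have "polar_norm K u \<le> polar_norm K v + norm (u - v)" for u v
  proof (rule polar_norm_le[OF assms(1)])
    fix y assume y: "y \<in> K"
    have "u \<bullet> y = v \<bullet> y + (u - v) \<bullet> y" by (simp add: inner_diff_left)
    also have "(u - v) \<bullet> y \<le> norm (u - v) * norm y" by (rule norm_cauchy_schwarz)
    also have "\<dots> \<le> norm (u - v) * 1" using y assms(2) by (intro mult_left_mono) auto
    finally show "u \<bullet> y \<le> polar_norm K v + norm (u - v)"
      using inner_le_polar_norm[OF bdd y, of v] by simp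
  qed
  from this[of u v] this[of v u] show ?thesis by (simp add: norm_minus_commute abs_le_iff)
qed

text \<open>Arzela--Ascoli for the support functions on the unit circle, which are bounded and
  1-Lipschitz. The conclusion is a Cauchy condition between bodies, so the limit function need not
  be recognised as a support function.\<close>

lemma blaschke_selection_subsequence:
  fixes K :: "nat \<Rightarrow> plane set"
  assumes K: "\<And>n. K n \<in> sym_convex_bodies" and up: "\<And>n. K n \<subseteq> cball 0 1"
    and "0 < \<rho>" and low: "\<And>n. cball 0 \<rho> \<subseteq> K n"
  obtains k :: "nat \<Rightarrow> nat" where "strict_mono k"
    "\<And>e. 0 < e \<Longrightarrow> \<exists>N. \<forall>i\<ge>N. \<forall>j\<ge>N. K (k i) \<subseteq> (*\<^sub>R) (1 + e) ` K (k j)"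
proof -
  note K' = sym_convex_bodiesD[OF K]
  have lower: "\<rho> \<le> polar_norm (K n) u" if "norm u = 1" for n u
  proof -
    have "\<rho> *\<^sub>R u \<in> K n" using that \<open>0 < \<rho>\<close> by (intro subsetD[OF low]) simp
    then have "u \<bullet> (\<rho> *\<^sub>R u) \<le> polar_norm (K n) u" by (rule inner_le_polar_norm[OF K'(3)])
    then show ?thesis using that by (simp add: dot_square_norm)
  qed
  have upper: "norm (polar_norm (K n) u) \<le> 1" if "u \<in> sphere 0 1" for n u
  proof -
    have "polar_norm (K n) u \<le> 1"
    proof (rule polar_norm_le[OF K'(1)])
      fix y assume "y \<in> K n"
      then have "norm y \<le> 1" using up by force
      then show "u \<bullet> y \<le> 1" using norm_cauchy_schwarz[of u y] that by simp
    qed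
    then show ?thesis using lower[of u n] that \<open>0 < \<rho>\<close> by simp
  qed
  obtain g k where k: "strict_mono (k :: nat \<Rightarrow> nat)"
    and g: "\<And>e. 0 < e \<Longrightarrow> \<exists>N. \<forall>n x. n \<ge> N \<and> x \<in> sphere 0 1 \<longrightarrow> norm (polar_norm (K (k n)) x - g x) < e"
  proof (rule Arzela_Ascoli[of "sphere 0 1" "\<lambda>n. polar_norm (K n)" 1])
    show "compact (sphere (0::plane) 1)" by simp
    show "norm (polar_norm (K n) x) \<le> 1" if "x \<in> sphere 0 1" for n x by (rule upper[OF that])
    show "\<exists>d. 0 < d \<and> (\<forall>n y. y \<in> sphere 0 1 \<and> norm (x - y) < d \<longrightarrow>
        norm (polar_norm (K n) x - polar_norm (K n) y) < e)" if "0 < e" for x e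
      using that polar_norm_lipschitz[OF K'(1) up] by (intro exI[of _ e]) (auto intro: le_less_trans)
  qed blast
  show ?thesis
  proof (rule that[OF k])
    fix e :: real assume "0 < e"
    \<comment> \<open>Since the support functions are at least \<open>\<rho>\<close>, an additive
      error \<open>e * \<rho>\<close> is a relative error of at most e.\<close>
    then have "0 < e * \<rho> / 2" using \<open>0 < \<rho>\<close> by simp
    then obtain N where N: "\<And>n x. n \<ge> N \<Longrightarrow> norm x = 1 \<Longrightarrow> \<bar>polar_norm (K (k n)) x - g x\<bar> < e * \<rho> / 2"
      using g by fastforce
    have "K (k i) \<subseteq> (*\<^sub>R) (1 + e) ` K (k j)" if "N \<le> i" "N \<le> j" for i j
    proof (rule subset_scaleR_if_polar_norm_le[OF K K])
      fix u :: plane assume u: "norm u = 1"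
      have "polar_norm (K (k i)) u \<le> polar_norm (K (k j)) u + e * \<rho>"
        using N[OF that(1) u] N[OF that(2) u] by linarith
      also have "e * \<rho> \<le> e * polar_norm (K (k j)) u"
        using lower[OF u] \<open>0 < e\<close> by (intro mult_left_mono) auto
      finally show "polar_norm (K (k i)) u \<le> (1 + e) * polar_norm (K (k j)) u"
        by (simp add: algebra_simps)
    qed (use \<open>0 < e\<close> in simp)
    then show "\<exists>N. \<forall>i\<ge>N. \<forall>j\<ge>N. K (k i) \<subseteq> (*\<^sub>R) (1 + e) ` K (k j)" by blast
  qed
qed

lemma blaschke_selection_limit:
  fixes L :: "nat \<Rightarrow> plane set"
  assumes L: "\<And>n. L n \<in> sym_convex_bodies" and up: "\<And>n. L n \<subseteq> cball 0 1"
    and cauchy: "\<And>e. 0 < e \<Longrightarrow> \<exists>N. \<forall>i\<ge>N. \<forall>j\<ge>N. L i \<subseteq> (*\<^sub>R) (1 + e) ` L j"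
  obtains M where "M \<in> sym_convex_bodies"
    "\<And>e. 0 < e \<Longrightarrow> \<exists>N. \<forall>n\<ge>N. (*\<^sub>R) (1 / (1 + e)) ` L n \<subseteq> M \<and> M \<subseteq> (*\<^sub>R) (1 + e) ` L n"
proof -
  note L' = sym_convex_bodiesD[OF L]
  \<comment> \<open>The set-theoretic lower limit inherits convexity and symmetry; its interior is
    the limit body. A shrunken \<open>L n\<close> lies in all later bodies, hence in U, and being
    open in its interior.\<close>
  define U where "U = (\<Union>m. \<Inter>n\<in>{m..}. L n)"
  define M where "M = interior U"
  have close: "\<exists>N. \<forall>n\<ge>N. (*\<^sub>R) (1 / (1 + e)) ` L n \<subseteq> M \<and> M \<subseteq> (*\<^sub>R) (1 + e) ` L n" if e: "0 < e" for e
  proof -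
    obtain N where N: "\<And>i j. N \<le> i \<Longrightarrow> N \<le> j \<Longrightarrow> L i \<subseteq> (*\<^sub>R) (1 + e) ` L j"
      using cauchy[OF e] by blast
    have "(*\<^sub>R) (1 / (1 + e)) ` L n \<subseteq> M" if n: "N \<le> n" for n
      unfolding M_def
    proof (rule interior_maximal)
      show "open ((*\<^sub>R) (1 / (1 + e)) ` L n)" using e L'(2) by (intro open_scaling) auto
      have "(1 / (1 + e)) *\<^sub>R x \<in> L j" if "x \<in> L n" "N \<le> j" for x j
      proof -
        obtain y where "y \<in> L j" "x = (1 + e) *\<^sub>R y" using N[OF n \<open>N \<le> j\<close>] \<open>x \<in> L n\<close> by blast
        then show ?thesis using e by simp
      qed
      then show "(*\<^sub>R) (1 / (1 + e)) ` L n \<subseteq> U" unfolding U_def by blast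
    qed
    moreover have "M \<subseteq> (*\<^sub>R) (1 + e) ` L n" if n: "N \<le> n" for n
    proof
      fix x assume "x \<in> M"
      then have "x \<in> U" using interior_subset by (auto simp: M_def)
      then obtain m where "\<And>j. m \<le> j \<Longrightarrow> x \<in> L j" by (auto simp: U_def)
      then have "x \<in> L (max m N)" by simp
      then show "x \<in> (*\<^sub>R) (1 + e) ` L n" using N[of "max m N" n] n by auto
    qed
    ultimately show ?thesis by blast
  qed
  have conv: "convex U"
  proof (rule convexI)
    fix x y :: plane and u v :: real
    assume "x \<in> U" "y \<in> U" and uv: "0 \<le> u" "0 \<le> v" "u + v = 1"
    then obtain m n where "\<And>j. m \<le> j \<Longrightarrow> x \<in> L j" "\<And>j. n \<le> j \<Longrightarrow> y \<in> L j" by (auto simp: U_def)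
    then have "u *\<^sub>R x + v *\<^sub>R y \<in> L j" if "max m n \<le> j" for j
      using that by (intro convexD[OF L'(4) _ _ uv]) auto
    then show "u *\<^sub>R x + v *\<^sub>R y \<in> U" unfolding U_def by blast
  qed
  have sym: "uminus ` U = U"
  proof -
    have "- x \<in> U" if "x \<in> U" for x using that L'(5) by (force simp: U_def)
    then show ?thesis by force
  qed
  have "M \<in> sym_convex_bodies"
    unfolding sym_convex_bodies_def
  proof (intro CollectI conjI ballI)
    obtain N where "(*\<^sub>R) (1 / (1 + 1)) ` L N \<subseteq> M" using close[of 1] by auto
    then show "M \<noteq> {}" using L'(1)[of N] by auto
    show "open M" by (simp add: M_def)
    have "M \<subseteq> U" by (simp add: M_def interior_subset)
    also have "U \<subseteq> cball 0 1" using up by (force simp: U_def)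
    finally show "bounded M" by (rule bounded_subset[rotated]) simp
    show "convex M" unfolding M_def using conv by (rule convex_interior)
    show "- x \<in> M" if "x \<in> M" for x
      using that interior_negations[of U] sym unfolding M_def by (metis imageI)
  qed
  then show ?thesis using close by (rule that)
qed


text \<open>A point outside K is separated by a polar vector of norm at most c, so it has norm at
  least 1 / c; half that radius leaves a strict margin.\<close>

lemma cball_subset_if_measure_polar_le:
  assumes K: "K \<in> sym_convex_bodies" "K \<subseteq> cball 0 1" and "measure lborel (polar K) \<le> c" and "0 < c"
  shows "cball 0 (1 / (2 * c)) \<subseteq> K"
proof
  fix x :: plane assume x: "x \<in> cball 0 (1 / (2 * c))"
  show "x \<in> K"
  proof (rule ccontr)
    assume "x \<notin> K"
    then obtain z where z: "z \<in> polar K" "z \<bullet> x = 1" by (rule polar_separation[OF K(1)])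
    have "1 \<le> norm z * norm x" using z(2) norm_cauchy_schwarz[of z x] by simp
    also have "\<dots> \<le> c * (1 / (2 * c))"
      using norm_le_measure_polar[OF K z(1)] assms(3,4) x by (intro mult_mono) auto
    finally show False using assms(4) by simp
  qed
qed

section \<open>Normalisation and the direct method\<close>

lemma normalized_body:
  assumes K: "K \<in> sym_convex_bodies"
  obtains K' y where "K' \<in> sym_convex_bodies" "K' \<subseteq> cball 0 1" "y \<in> K'" "1 / 2 \<le> norm y"
    "cheeger_functional \<Omega> K' \<le> cheeger_functional \<Omega> K"
proof -
  note K' = sym_convex_bodiesD[OF K]
  obtain r where r: "0 < r" "ball 0 r \<subseteq> K" by (rule sym_convex_bodies_ball[OF K])
  obtain b where b: "\<And>x. x \<in> K \<Longrightarrow> norm x \<le> b" using K'(3) by (auto simp: bounded_iff)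
  define R where "R = (SUP x\<in>K. norm x)"
  have bdd: "bdd_above (norm ` K)" using b by (auto simp: bdd_above_def)
  have R: "norm x \<le> R" if "x \<in> K" for x unfolding R_def by (rule cSUP_upper[OF that bdd])
  obtain v :: plane where "norm v = r / 2" using vector_choose_size[of "r / 2"] r(1) by auto
  then have "0 < R" using R[of v] r by (force simp: subset_eq)
  then have "R / 2 < (SUP x\<in>K. norm x)" by (simp add: R_def[symmetric])
  \<comment> \<open>K is open and does not attain the supremum R of the norm, hence a point with
    more than half of it.\<close>
  then obtain x where x: "x \<in> K" "R / 2 < norm x" using less_cSUP_iff[OF K'(1) bdd] by auto
  define L where "L = (*\<^sub>R) (1 / R) ` K"
  have L: "L \<in> sym_convex_bodies"
    unfolding sym_convex_bodies_def
  proof (intro CollectI conjI ballI)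
    show "L \<noteq> {}" "open L" "bounded L" "convex L"
      using K' \<open>0 < R\<close> by (auto simp: L_def intro: open_scaling bounded_scaling convex_scaling)
    show "- x \<in> L" if "x \<in> L" for x
      using that K'(5) by (auto simp: L_def scaleR_minus_right[symmetric] simp del: scaleR_minus_right)
  qed
  show ?thesis
  proof (rule that[OF L])
    show "L \<subseteq> cball 0 1" using R \<open>0 < R\<close> by (auto simp: L_def field_simps)
    show "(1 / R) *\<^sub>R x \<in> L" using x(1) unfolding L_def by (rule imageI)
    show "1 / 2 \<le> norm ((1 / R) *\<^sub>R x)" using x(2) \<open>0 < R\<close> by (simp add: field_simps)
    \<comment> \<open>Both inclusions hold with the same factor 1 / R, which is the scaling
      invariance.\<close>
    have "cheeger_functional \<Omega> L \<le> ennreal ((1 / R) / (1 / R)) * cheeger_functional \<Omega> K"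
      using \<open>0 < R\<close> by (intro cheeger_functional_le_mult K L) (auto simp: L_def)
    then show "cheeger_functional \<Omega> L \<le> cheeger_functional \<Omega> K" using \<open>0 < R\<close> by simp
  qed
qed

lemma measure_polar_le_if_cheeger_functional_le:
  assumes K: "K \<in> sym_convex_bodies" and y: "y \<in> K" "1 / 2 \<le> norm y"
    and \<Omega>: "\<Omega> \<subseteq> ball 0 R" "0 < R" and c: "cheeger_functional \<Omega> K \<le> ennreal c" "0 \<le> c"
  shows "measure lborel (polar K) \<le> (64 * pi * R * c)\<^sup>2"
proof -
  let ?m = "measure lborel (polar K)"
  note K' = sym_convex_bodiesD[OF K]
  \<comment> \<open>The bound norm y \<ge> 1 / 2 turns 32 into 64.\<close>
  have "ennreal (1 / (64 * pi * R)) \<le> ennreal (norm y / (32 * pi * R))"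
    using y(2) \<Omega>(2) by (intro ennreal_leI) (simp add: field_simps)
  also have "\<dots> \<le> cheeger_const K \<Omega>"
    using K' y(1) by (intro cheeger_const_lower_bound \<Omega>) auto
  finally have "ennreal (1 / (64 * pi * R)) * ennreal (sqrt ?m) \<le> cheeger_functional \<Omega> K"
    unfolding cheeger_functional_def by (rule mult_right_mono) simp
  then have "ennreal (1 / (64 * pi * R) * sqrt ?m) \<le> ennreal c"
    using c(1) \<Omega>(2) by (subst ennreal_mult) auto
  then have "sqrt ?m \<le> 64 * pi * R * c"
    using c(2) \<Omega>(2) by (simp add: field_simps)
  then show ?thesis
    by (rule sqrt_le_D)
qed

theorem proposition3p3:
  fixes \<Omega> :: "(real ^ 2) set"
  assumes "\<Omega> \<noteq> {}" and "open \<Omega>" and "bounded \<Omega>" and "convex \<Omega>"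
  shows "\<exists>Khat\<in>sym_convex_bodies. \<forall>K\<in>sym_convex_bodies.
           cheeger_functional \<Omega> Khat \<le> cheeger_functional \<Omega> K"
proof -
  let ?J = "cheeger_functional \<Omega>"
  define m where "m = (INF K\<in>sym_convex_bodies. ?J K)"
  have m_le: "m \<le> ?J K" if "K \<in> sym_convex_bodies" for K
    unfolding m_def using that by (rule INF_lower)
  have ball: "ball 0 1 \<in> sym_convex_bodies" by (auto simp: sym_convex_bodies_def)
  show ?thesis
  \<comment> \<open>If the infimum is top, every body attains it.\<close>
  proof (cases "m = top")
    case True
    then show ?thesis using ball m_le by (intro bexI[OF _ ball]) (simp add: top_unique)
  next
    case False
    then obtain m' where m': "0 \<le> m'" "m = ennreal m'" by (cases m) auto
    obtain R where R: "0 < R" "\<Omega> \<subseteq> ball 0 R"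
      using bounded_subset_ballD[OF assms(3), of 0] by blast
    have "\<exists>K y. K \<in> sym_convex_bodies \<and> K \<subseteq> cball 0 1 \<and> y \<in> K \<and> 1 / 2 \<le> norm y \<and>
        ?J K \<le> ennreal (m' + inverse (real (Suc n)))" for n
    proof -
      have "m < ennreal (m' + inverse (real (Suc n)))"
        unfolding m'(2) using m'(1) by (subst ennreal_less_iff) auto
      then obtain K where K: "K \<in> sym_convex_bodies" "?J K < ennreal (m' + inverse (real (Suc n)))"
        unfolding m_def INF_less_iff by blast
      obtain K' y where "K' \<in> sym_convex_bodies" "K' \<subseteq> cball 0 1" "y \<in> K'" "1 / 2 \<le> norm y" "?J K' \<le> ?J K"
        by (rule normalized_body[OF K(1)])
      then show ?thesis using K(2) by (meson le_less_trans less_imp_le)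
    qed
    then obtain K y where K: "\<And>n. K n \<in> sym_convex_bodies" and up: "\<And>n. K n \<subseteq> cball 0 1"
      and y: "\<And>n. y n \<in> K n" "\<And>n. 1 / 2 \<le> norm (y n)"
      and J: "\<And>n. ?J (K n) \<le> ennreal (m' + inverse (real (Suc n)))"
      by metis
    \<comment> \<open>The area bound at the value m' + 1, which is at least m' + 1 / (n + 1) for
      every n.\<close>
    define c where "c = (64 * pi * R * (m' + 1))\<^sup>2"
    have "0 < 64 * pi * R * (m' + 1)" using R(1) m'(1) by simp
    then have "0 < c" unfolding c_def by (rule zero_less_power)
    have low: "cball 0 (1 / (2 * c)) \<subseteq> K n" for n
    proof (rule cball_subset_if_measure_polar_le[OF K up _ \<open>0 < c\<close>])
      have "m' + inverse (real (Suc n)) \<le> m' + 1" by (simp add: inverse_eq_divide)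
      then have "?J (K n) \<le> ennreal (m' + 1)" using J[of n] by (meson ennreal_leI order_trans)
      then show "measure lborel (polar (K n)) \<le> c"
        unfolding c_def using m'(1)
        by (intro measure_polar_le_if_cheeger_functional_le[OF K y R(2,1)]) auto
    qed
    have "0 < 1 / (2 * c)" using \<open>0 < c\<close> by simp
    then obtain k :: "nat \<Rightarrow> nat" where k: "strict_mono k"
      and cauchy: "\<And>e. 0 < e \<Longrightarrow> \<exists>N. \<forall>i\<ge>N. \<forall>j\<ge>N. K (k i) \<subseteq> (*\<^sub>R) (1 + e) ` K (k j)"
      using blaschke_selection_subsequence[of K, OF K up _ low] by blast
    obtain Khat where Khat: "Khat \<in> sym_convex_bodies"
      and close: "\<And>e. 0 < e \<Longrightarrow>
        \<exists>N. \<forall>n\<ge>N. (*\<^sub>R) (1 / (1 + e)) ` K (k n) \<subseteq> Khat \<and> Khat \<subseteq> (*\<^sub>R) (1 + e) ` K (k n)"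
      using blaschke_selection_limit[of "\<lambda>n. K (k n)", OF K up cauchy] by blast
    have bound: "?J Khat \<le> ennreal ((1 + e)\<^sup>2 * (m' + e))" if e: "0 < e" for e
    proof -
      obtain N where N: "\<And>n. N \<le> n \<Longrightarrow> (*\<^sub>R) (1 / (1 + e)) ` K (k n) \<subseteq> Khat \<and> Khat \<subseteq> (*\<^sub>R) (1 + e) ` K (k n)"
        using close[OF e] by blast
      obtain M where M: "inverse (real (Suc M)) < e" using reals_Archimedean[OF e] by blast
      \<comment> \<open>N makes the body close to the limit. M makes the value nearly minimal,
        because k n \<ge> n.\<close>
      define n where "n = max N M"
      have "M \<le> k n" using seq_suble[OF k, of n] by (simp add: n_def)
      then have "inverse (real (Suc (k n))) \<le> inverse (real (Suc M))" by (intro le_imp_inverse_le) auto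
      then have "inverse (real (Suc (k n))) \<le> e" using M by linarith
      then have Jn: "?J (K (k n)) \<le> ennreal (m' + e)"
        using J[of "k n"] by (meson add_left_mono ennreal_leI order_trans)
      \<comment> \<open>Inner factor 1 / (1 + e) and outer factor 1 + e combine to (1 +
        e)^2.\<close>
      have "?J Khat \<le> ennreal ((1 + e) / (1 / (1 + e))) * ?J (K (k n))"
        using N[of n] e by (intro cheeger_functional_le_mult K Khat) (auto simp: n_def)
      also have "\<dots> \<le> ennreal ((1 + e) / (1 / (1 + e))) * ennreal (m' + e)"
        by (intro mult_left_mono Jn) auto
      also have "\<dots> = ennreal ((1 + e)\<^sup>2 * (m' + e))"
        using e m'(1) by (subst ennreal_mult[symmetric]) (auto simp: power2_eq_square)
      finally show ?thesis .
    qed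
    have "((\<lambda>e. ennreal ((1 + e)\<^sup>2 * (m' + e))) \<longlongrightarrow> ennreal ((1 + 0)\<^sup>2 * (m' + 0))) (at_right 0)"
      by (intro tendsto_intros)
    moreover have "\<forall>\<^sub>F e in at_right 0. ?J Khat \<le> ennreal ((1 + e)\<^sup>2 * (m' + e))"
      using bound by (auto simp: eventually_at_filter)
    ultimately have "?J Khat \<le> ennreal ((1 + 0)\<^sup>2 * (m' + 0))"
      by (rule tendsto_lowerbound) simp
    then have "?J Khat \<le> m" by (simp add: m'(2))
    then show ?thesis using Khat m_le order_trans by blast
  qed
qed

end
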